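(* Let $s\in(0,1)$ and let $p\in C_+(\mathbb{R}^N\times\mathbb{R}^N)$ be a uniformly continuous and symmetric function (i.e. $p(x,y)=p(y,x)$ for all $x,y\in\mathbb{R}^N$) such that $sp^+<N$, where $p^+:=\sup_{\mathbb{R}^N\times\mathbb{R}^N}p$. For $x\in\mathbb{R}^N$ put $p_s^*(x):=\frac{Np(x,x)}{N-sp(x,x)}$. Then: (i) $W^{s,p(\cdot,\cdot)}(\mathbb{R}^N)$ is continuously imbedded in $L^{r(\cdot)}(\mathbb{R}^N)$ for any uniformly continuous function $r\in C_+(\mathbb{R}^N)$ satisfying $p(x,x)\le r(x)$ for all $x\in\mathbb{R}^N$ and $\inf_{x\in\mathbb{R}^N}\big(p_s^*(x)-r(x)\big)>0$; (ii) $W^{s,p(\cdot,\cdot)}(\mathbb{R}^N)$ is compactly imbedded in $L^{r(\cdot)}_{\mathrm{loc}}(\mathbb{R}^N)$ for any $r\in C_+(\mathbb{R}^N)$ satisfying $r(x)<p_s^*(x)$ for all $x\in\mathbb{R}^N$.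
   Context: For $k\in\mathbb{N}$, $C_+(\mathbb{R}^k)$ is the set of continuous $h:\mathbb{R}^k\to\mathbb{R}$ with $1<\inf h\le\sup h<\infty$ (and $C_+(\mathbb{R}^N\times\mathbb{R}^N)$ is this set for $k=2N$). For a domain $\Omega\subset\mathbb{R}^N$ and $h\in C_+(\overline\Omega)$ (continuous on $\overline\Omega$ with $1<\inf h\le\sup h<\infty$), $L^{h(\cdot)}(\Omega)$ is the set of measurable $u:\Omega\to\mathbb{R}$ with $\int_\Omega|u(x)|^{h(x)}\,dx<\infty$, endowed with the norm $\|u\|_{L^{h(\cdot)}(\Omega)}=\inf\{\lambda>0:\int_\Omega|u(x)/\lambda|^{h(x)}\,dx\le1\}$. The space $W^{s,p(\cdot,\cdot)}(\mathbb{R}^N)$ consists of all measurable $u:\mathbb{R}^N\to\mathbb{R}$ with $\int_{\mathbb{R}^N}|u(x)|^{p(x,x)}\,dx<\infty$ and $$\int_{\mathbb{R}^N}\int_{\mathbb{R}^N}\frac{|u(x)-u(y)|^{p(x,y)}}{|x-y|^{N+sp(x,y)}}\,dx\,dy<\infty,$$ endowed with the norm $\|u\|_{L^{\bar p(\cdot)}(\mathbb{R}^N)}+[u]_{s,p(\cdot,\cdot),\mathbb{R}^N}$, where $\bar p(x):=p(x,x)$ and $$[u]_{s,p(\cdot,\cdot),\mathbb{R}^N}:=\inf\Big\{\lambda>0:\int_{\mathbb{R}^N}\int_{\mathbb{R}^N}\frac{|u(x)-u(y)|^{p(x,y)}}{\lambda^{p(x,y)}|x-y|^{N+sp(x,y)}}\,dx\,dy<1\Big\}.$$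 The compact imbedding into $L^{r(\cdot)}_{\mathrm{loc}}(\mathbb{R}^N)$ means that for every ball $B\subset\mathbb{R}^N$ the restriction map $u\mapsto u|_B$ is a compact linear operator from $W^{s,p(\cdot,\cdot)}(\mathbb{R}^N)$ into $L^{r(\cdot)}(B)$. *)

theory Defs
  imports "HOL-Analysis.Analysis"
begin

definition C_plus :: "'a::topological_space set \<Rightarrow> ('a \<Rightarrow> real) set" where
  "C_plus S = {h. continuous_on S h \<and> bdd_below (h ` S) \<and> 1 < (INF x\<in>S. h x) \<and> bdd_above (h ` S)}"

(* A function on Omega is represented by a total function of which only the values on Omega
   matter: restriction to a subdomain is the identity on representatives. As usual, functions
   that agree almost everywhere are not distinguished by the norms below. *)

definition modular_L :: "'a::euclidean_space set \<Rightarrow> ('a \<Rightarrow> real) \<Rightarrow> ('a \<Rightarrow> real) \<Rightarrow> ennreal" where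
  "modular_L \<Omega> h u = (\<integral>\<^sup>+x. ennreal (\<bar>u x\<bar> powr h x) \<partial>lebesgue_on \<Omega>)"

definition var_Lebesgue :: "'a::euclidean_space set \<Rightarrow> ('a \<Rightarrow> real) \<Rightarrow> ('a \<Rightarrow> real) set" where
  "var_Lebesgue \<Omega> h = {u \<in> borel_measurable (lebesgue_on \<Omega>). modular_L \<Omega> h u < \<infinity>}"

definition norm_L :: "'a::euclidean_space set \<Rightarrow> ('a \<Rightarrow> real) \<Rightarrow> ('a \<Rightarrow> real) \<Rightarrow> real" where
  "norm_L \<Omega> h u = Inf {l. 0 < l \<and> modular_L \<Omega> h (\<lambda>x. u x / l) \<le> 1}"

definition modular_Gagliardo ::
  "real \<Rightarrow> ((real^'n) \<times> (real^'n) \<Rightarrow> real) \<Rightarrow> real \<Rightarrow> (real^'n \<Rightarrow> real) \<Rightarrow> ennreal" where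
  "modular_Gagliardo s p l u =
     (\<integral>\<^sup>+y. (\<integral>\<^sup>+x. ennreal (\<bar>u x - u y\<bar> powr p (x, y) /
        (l powr p (x, y) * norm (x - y) powr (real CARD('n) + s * p (x, y)))) \<partial>lebesgue) \<partial>lebesgue)"

definition frac_Sobolev ::
  "real \<Rightarrow> ((real^'n) \<times> (real^'n) \<Rightarrow> real) \<Rightarrow> (real^'n \<Rightarrow> real) set" where
  "frac_Sobolev s p = {u \<in> borel_measurable lebesgue.
     modular_L UNIV (\<lambda>x. p (x, x)) u < \<infinity> \<and> modular_Gagliardo s p 1 u < \<infinity>}"

definition seminorm_W ::
  "real \<Rightarrow> ((real^'n) \<times> (real^'n) \<Rightarrow> real) \<Rightarrow> (real^'n \<Rightarrow> real) \<Rightarrow> real" where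
  "seminorm_W s p u = Inf {l. 0 < l \<and> modular_Gagliardo s p l u < 1}"

definition norm_W ::
  "real \<Rightarrow> ((real^'n) \<times> (real^'n) \<Rightarrow> real) \<Rightarrow> (real^'n \<Rightarrow> real) \<Rightarrow> real" where
  "norm_W s p u = norm_L UNIV (\<lambda>x. p (x, x)) u + seminorm_W s p u"

definition crit_exp ::
  "real \<Rightarrow> ((real^'n) \<times> (real^'n) \<Rightarrow> real) \<Rightarrow> real^'n \<Rightarrow> real" where
  "crit_exp s p x = real CARD('n) * p (x, x) / (real CARD('n) - s * p (x, x))"

definition continuously_imbedded ::
  "('a \<Rightarrow> real) set \<Rightarrow> (('a \<Rightarrow> real) \<Rightarrow> real) \<Rightarrow> ('a \<Rightarrow> real) set \<Rightarrow> (('a \<Rightarrow> real) \<Rightarrow> real) \<Rightarrow> bool" where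
  "continuously_imbedded X nX Y nY \<longleftrightarrow>
     X \<subseteq> Y \<and> (\<exists>C>0. \<forall>u\<in>X. nY u \<le> C * nX u)"

(* The imbedding is a compact operator: it is bounded and every bounded sequence in X
   has a subsequence converging in Y. *)
definition compactly_imbedded ::
  "('a \<Rightarrow> real) set \<Rightarrow> (('a \<Rightarrow> real) \<Rightarrow> real) \<Rightarrow> ('a \<Rightarrow> real) set \<Rightarrow> (('a \<Rightarrow> real) \<Rightarrow> real) \<Rightarrow> bool" where
  "compactly_imbedded X nX Y nY \<longleftrightarrow>
     continuously_imbedded X nX Y nY \<and>
     (\<forall>u :: nat \<Rightarrow> 'a \<Rightarrow> real. (\<forall>n. u n \<in> X) \<and> (\<exists>M. \<forall>n. nX (u n) \<le> M) \<longrightarrow>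
        (\<exists>v\<in>Y. \<exists>\<sigma> :: nat \<Rightarrow> nat. strict_mono \<sigma> \<and>
           (\<lambda>n. nY (\<lambda>x. u (\<sigma> n) x - v x)) \<longlonglongrightarrow> 0))"

end

theory Submission
  imports Defs "HOL-Complex_Analysis.Great_Picard"
begin

text \<open>
  Let \<open>G u x\<close> be the inner integral of the Gagliardo modular of \<open>u\<close>, taken at the point \<open>x\<close>, and
  normalise \<open>u\<close> so that both its modulars are at most 1.  Write \<open>q*\<close> for the critical exponent.
  The whole proof rests on one pointwise inequality (\<open>gagliardo_density_ge\<close>): if \<open>\<bar>u x\<bar> \<ge> 2 l\<close>
  and the level set \<open>{\<bar>u\<bar> > l}\<close> fills at most half of the ball of radius \<open>\<rho> \<le> 1\<close> around \<open>x\<close>, then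
  on the other half of that ball \<open>u\<close> differs from \<open>u x\<close> by at least \<open>l\<close>, and so
  \<open>G u x \<ge> c l^P \<rho>^(- s P)\<close> for every lower bound \<open>P\<close> of the exponent near \<open>x\<close>.  For large \<open>l\<close> and
  small \<open>\<rho>\<close> only lower bounds of the exponent enter, so its variability costs nothing beyond its
  small oscillation over small balls.

  This inequality improves integrability.  Suppose that the integral of \<open>\<bar>u\<bar>^q\<close> over \<open>{\<bar>u\<bar> > \<Lambda>}\<close>
  is bounded for all normalised \<open>u\<close>, and let \<open>Q\<close> be a lower bound of \<open>q\<close> near \<open>x\<close>.  By Chebyshev's
  inequality the level set has measure at most \<open>C l^(-Q)\<close> near \<open>x\<close>, so a radius with
  \<open>\<rho>^N\<close> comparable to \<open>l^(-Q)\<close> is admissible, and with \<open>l = \<bar>u x\<bar> / 2\<close> one obtains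
  \<open>\<bar>u x\<bar>^(P + s P Q / N) \<le> C' G u x\<close>.  Integration bounds the integral of the new power.  Up to an
  arbitrarily small loss, the exponent has moved along the affine map \<open>q \<mapsto> p + (s p / N) q\<close>, whose
  fixed point is \<open>q*\<close> and whose slope is at most \<open>s sup p / N < 1\<close>.  Starting from \<open>q = p\<close>, finitely
  many steps reach \<open>q* - \<kappa> (q* - p)\<close> for any prescribed \<open>\<kappa> > 0\<close>
  (\<open>tail_bound_step\<close>, \<open>tail_bound_all\<close>).

  The continuous imbedding follows: large values of \<open>u\<close> are controlled by the tail bound, small ones
  by \<open>\<bar>u\<bar>^p\<close> because \<open>p \<le> r\<close>; on a set of finite measure, small values are harmless for any \<open>r\<close>.
  A bound of the modular on normalised functions is a bound of the norm, by homogeneity.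

  For compactness, \<open>G u x\<close> also bounds the distance of \<open>u x\<close> from the mean of \<open>u\<close> over any ball of
  radius \<open>h\<close> containing \<open>x\<close>, with a factor \<open>h^(s/2)\<close> (\<open>average_oscillation_le\<close>).  A diagonal argument
  makes all means over countably many balls converge along a subsequence, so that this subsequence is
  Cauchy in \<open>L\<^sup>1\<close> of a bounded set (\<open>modular_ball_L1_precompact\<close>) and a further one converges almost
  everywhere.  The tail bound with an exponent slightly above \<open>r\<close> prevents concentration, and this
  turns almost everywhere convergence into convergence of the modular
  (\<open>modular_tendsto_0_of_AE\<close>).
\<close>

section \<open>Preliminaries on continuity and Lebesgue measurability\<close>

lemma uniformly_continuous_on_mono:
  fixes f :: "'a::metric_space \<Rightarrow> 'b::metric_space"
  shows "uniformly_continuous_on B f \<Longrightarrow> A \<subseteq> B \<Longrightarrow> uniformly_continuous_on A f"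
  unfolding uniformly_continuous_on_def by (meson subsetD)

lemma borel_imp_lebesgue: "f \<in> borel_measurable borel \<Longrightarrow> f \<in> borel_measurable (lebesgue :: 'a::euclidean_space measure)"
  by (auto intro: measurable_completion)

lemma emeasure_ball_lebesgue:
  "0 \<le> \<rho> \<Longrightarrow> emeasure lebesgue (ball (x::real^'n) \<rho>) = ennreal (unit_ball_vol (real CARD('n)) * \<rho> ^ CARD('n))"
  by (simp add: emeasure_ball)

text \<open>
  Completeness of Lebesgue measure, for functions with values in the extended half line.
\<close>

lemma borel_measurable_lebesgue_AE:
  fixes f g :: "'a::euclidean_space \<Rightarrow> ennreal"
  assumes "f \<in> borel_measurable lebesgue" "AE x in lebesgue. f x = g x"
  shows "g \<in> borel_measurable lebesgue"
proof (rule borel_measurableI_greater)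
  fix a :: ennreal
  have "AE x in lebesgue. x \<in> {x\<in>space lebesgue. a < f x} \<longleftrightarrow> x \<in> {x\<in>space lebesgue. a < g x}"
    using assms(2) by eventually_elim simp
  moreover have "{x\<in>space lebesgue. a < f x} \<in> sets lebesgue"
    using assms(1) by measurable
  ultimately show "{x\<in>space lebesgue. a < g x} \<in> sets lebesgue"
    by (rule completion.in_sets_AE) auto
qed

section \<open>Modulars and Luxemburg norms\<close>

lemma modular_L_mono:
  assumes "\<And>x. x \<in> \<Omega> \<Longrightarrow> 0 \<le> h x" "\<And>x. x \<in> \<Omega> \<Longrightarrow> \<bar>u x\<bar> \<le> \<bar>v x\<bar>"
  shows "modular_L \<Omega> h u \<le> modular_L \<Omega> h v"
  unfolding modular_L_def using assms
  by (intro nn_integral_mono ennreal_leI powr_mono2) auto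

text \<open>
  Here the exponent being at least 1 matters: it makes the modular shrink at least linearly under
  division, so that a finite modular can be scaled below 1 and a modular bound \<open>C\<close> becomes a norm
  bound \<open>C\<close>.
\<close>

lemma powr_divide_le:
  fixes a l h :: real
  assumes "1 \<le> l" "1 \<le> h"
  shows "\<bar>a / l\<bar> powr h \<le> 1 / l * \<bar>a\<bar> powr h"
proof -
  have "l powr 1 \<le> l powr h" using assms by (intro powr_mono) auto
  then have "\<bar>a\<bar> powr h / l powr h \<le> \<bar>a\<bar> powr h / l"
    using assms by (intro divide_left_mono) auto
  then show ?thesis using assms by (simp add: powr_divide)
qed

lemma modular_L_divide_le:
  assumes [measurable]: "u \<in> borel_measurable (lebesgue_on \<Omega>)" "h \<in> borel_measurable (lebesgue_on \<Omega>)"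
    and h: "\<And>x. x \<in> \<Omega> \<Longrightarrow> 1 \<le> h x" and l: "1 \<le> l"
  shows "modular_L \<Omega> h (\<lambda>x. u x / l) \<le> ennreal (1 / l) * modular_L \<Omega> h u"
proof -
  have "modular_L \<Omega> h (\<lambda>x. u x / l) \<le> (\<integral>\<^sup>+x. ennreal (1 / l) * ennreal (\<bar>u x\<bar> powr h x) \<partial>lebesgue_on \<Omega>)"
    unfolding modular_L_def
  proof (intro nn_integral_mono)
    fix x assume "x \<in> space (lebesgue_on \<Omega>)"
    then have "ennreal (\<bar>u x / l\<bar> powr h x) \<le> ennreal (1 / l * \<bar>u x\<bar> powr h x)"
      using h l by (intro ennreal_leI powr_divide_le) auto
    also have "\<dots> = ennreal (1 / l) * ennreal (\<bar>u x\<bar> powr h x)"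
      using l by (intro ennreal_mult) auto
    finally show "ennreal (\<bar>u x / l\<bar> powr h x) \<le> ennreal (1 / l) * ennreal (\<bar>u x\<bar> powr h x)" .
  qed
  also have "\<dots> = ennreal (1 / l) * modular_L \<Omega> h u"
    unfolding modular_L_def by (intro nn_integral_cmult) measurable
  finally show ?thesis .
qed

lemma modular_L_scale_up:
  assumes [measurable]: "u \<in> borel_measurable (lebesgue_on \<Omega>)" "h \<in> borel_measurable (lebesgue_on \<Omega>)"
    and h: "\<And>x. x \<in> \<Omega> \<Longrightarrow> h x \<le> H" and l: "1 \<le> l"
  shows "modular_L \<Omega> h (\<lambda>x. l * u x) \<le> ennreal (l powr H) * modular_L \<Omega> h u"
proof -
  have "modular_L \<Omega> h (\<lambda>x. l * u x) \<le> (\<integral>\<^sup>+x. ennreal (l powr H) * ennreal (\<bar>u x\<bar> powr h x) \<partial>lebesgue_on \<Omega>)"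
    unfolding modular_L_def
  proof (intro nn_integral_mono)
    fix x assume "x \<in> space (lebesgue_on \<Omega>)"
    then have "l powr h x * \<bar>u x\<bar> powr h x \<le> l powr H * \<bar>u x\<bar> powr h x"
      using h l by (intro mult_right_mono powr_mono) auto
    then have "ennreal (l powr h x * \<bar>u x\<bar> powr h x) \<le> ennreal (l powr H * \<bar>u x\<bar> powr h x)"
      by (rule ennreal_leI)
    then show "ennreal (\<bar>l * u x\<bar> powr h x) \<le> ennreal (l powr H) * ennreal (\<bar>u x\<bar> powr h x)"
      using l by (simp add: ennreal_mult abs_mult powr_mult)
  qed
  also have "\<dots> = ennreal (l powr H) * modular_L \<Omega> h u"
    unfolding modular_L_def by (intro nn_integral_cmult) measurable
  finally show ?thesis .
qed

lemma norm_L_le: "0 < l \<Longrightarrow> modular_L \<Omega> h (\<lambda>x. u x / l) \<le> 1 \<Longrightarrow> norm_L \<Omega> h u \<le> l"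
  unfolding norm_L_def by (intro cInf_lower bdd_belowI[of _ 0]) auto

lemma ex_scaled_modular_L_le_1:
  assumes u: "u \<in> var_Lebesgue \<Omega> h" and h: "h \<in> borel_measurable (lebesgue_on \<Omega>)" "\<And>x. x \<in> \<Omega> \<Longrightarrow> 1 \<le> h x"
  obtains l where "0 < l" "modular_L \<Omega> h (\<lambda>x. u x / l) \<le> 1"
proof -
  obtain m where m: "0 \<le> m" "modular_L \<Omega> h u = ennreal m"
    using u by (cases "modular_L \<Omega> h u") (auto simp: var_Lebesgue_def)
  have "modular_L \<Omega> h (\<lambda>x. u x / (m + 1)) \<le> ennreal (1 / (m + 1)) * modular_L \<Omega> h u"
    using u h m by (intro modular_L_divide_le) (auto simp: var_Lebesgue_def)
  also have "\<dots> = ennreal (m / (m + 1))" using m by (simp add: ennreal_mult[symmetric])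
  also have "\<dots> \<le> 1" using m by simp
  finally show thesis using m by (intro that[of "m + 1"]) auto
qed

lemma norm_L_nonneg:
  assumes "u \<in> var_Lebesgue \<Omega> h" "h \<in> borel_measurable (lebesgue_on \<Omega>)" "\<And>x. x \<in> \<Omega> \<Longrightarrow> 1 \<le> h x"
  shows "0 \<le> norm_L \<Omega> h u"
proof -
  obtain l where "0 < l" "modular_L \<Omega> h (\<lambda>x. u x / l) \<le> 1"
    by (rule ex_scaled_modular_L_le_1[OF assms])
  then show ?thesis unfolding norm_L_def by (intro cInf_greatest) auto
qed

text \<open>
  Admissible scalings form an upward closed set, so every number strictly above their infimum is
  admissible, whether or not the infimum is attained.
\<close>

lemma modular_L_le_1_of_norm_less:
  assumes "u \<in> var_Lebesgue \<Omega> h" "h \<in> borel_measurable (lebesgue_on \<Omega>)" and h: "\<And>x. x \<in> \<Omega> \<Longrightarrow> 1 \<le> h x"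
    and "norm_L \<Omega> h u < l"
  shows "modular_L \<Omega> h (\<lambda>x. u x / l) \<le> 1"
proof -
  obtain l1 where "0 < l1" "modular_L \<Omega> h (\<lambda>x. u x / l1) \<le> 1"
    by (rule ex_scaled_modular_L_le_1[OF assms(1-3)])
  then obtain k where k: "0 < k" "modular_L \<Omega> h (\<lambda>x. u x / k) \<le> 1" "k < l"
    using assms(4) unfolding norm_L_def by (auto dest!: cInf_lessD[rotated])
  have "modular_L \<Omega> h (\<lambda>x. u x / l) \<le> modular_L \<Omega> h (\<lambda>x. u x / k)"
  proof (intro modular_L_mono)
    show "0 \<le> h x" if "x \<in> \<Omega>" for x using h[OF that] by simp
    show "\<bar>u x / l\<bar> \<le> \<bar>u x / k\<bar>" for x
      using k by (simp add: frac_le)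
  qed
  with k show ?thesis by simp
qed

lemma norm_L_tendsto_0:
  assumes "\<And>e. 0 < e \<Longrightarrow> \<forall>\<^sub>F n in sequentially. modular_L \<Omega> h (\<lambda>x. w n x / e) \<le> 1"
  shows "(\<lambda>n. norm_L \<Omega> h (w n)) \<longlonglongrightarrow> 0"
proof (rule tendstoI)
  fix e :: real assume "0 < e"
  then have "\<forall>\<^sub>F n in sequentially. modular_L \<Omega> h (\<lambda>x. w n x / (e / 2)) \<le> 1" by (intro assms) simp
  then show "\<forall>\<^sub>F n in sequentially. dist (norm_L \<Omega> h (w n)) 0 < e"
  proof eventually_elim
    case (elim n)
    have "norm_L \<Omega> h (w n) \<le> e / 2" using \<open>0 < e\<close> elim by (intro norm_L_le) auto
    moreover have "0 \<le> norm_L \<Omega> h (w n)"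
      unfolding norm_L_def using \<open>0 < e\<close> elim by (intro cInf_greatest) (auto intro!: exI[of _ "e / 2"])
    ultimately show ?case using \<open>0 < e\<close> by simp
  qed
qed

section \<open>Almost everywhere limits and convergence of modulars\<close>

text \<open>
  Along a subsequence the increments have \<open>L\<^sup>1\<close> norms at most \<open>2^(-k)\<close>; their sum is then integrable,
  hence finite almost everywhere, and the telescoping series converges.
\<close>

lemma L1_Cauchy_imp_AE_convergent_subseq:
  fixes f :: "nat \<Rightarrow> 'a \<Rightarrow> real"
  assumes f [measurable]: "\<And>n. f n \<in> borel_measurable M"
    and cauchy: "\<And>e. 0 < e \<Longrightarrow> \<exists>N. \<forall>m\<ge>N. \<forall>n\<ge>N. (\<integral>\<^sup>+x. ennreal \<bar>f m x - f n x\<bar> \<partial>M) \<le> ennreal e"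
  obtains v \<sigma> where "v \<in> borel_measurable M" "strict_mono (\<sigma> :: nat \<Rightarrow> nat)"
    "AE x in M. (\<lambda>n. f (\<sigma> n) x) \<longlonglongrightarrow> v x"
proof -
  have "\<exists>N. \<forall>m\<ge>N. \<forall>n\<ge>N. (\<integral>\<^sup>+x. ennreal \<bar>f m x - f n x\<bar> \<partial>M) \<le> ennreal ((1/2) ^ k)" for k :: nat
    by (rule cauchy) simp
  then obtain N where N: "\<And>k m n. N k \<le> m \<Longrightarrow> N k \<le> n \<Longrightarrow>
      (\<integral>\<^sup>+x. ennreal \<bar>f m x - f n x\<bar> \<partial>M) \<le> ennreal ((1/2) ^ k)"
    by metis
  \<comment> \<open>Partial sums dominate every \<open>N k\<close> and increase strictly, whatever \<open>N\<close> is.\<close>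
  define \<sigma> where "\<sigma> k = (\<Sum>i\<le>k. Suc (N i))" for k
  have mono: "strict_mono \<sigma>" by (intro strict_mono_Suc_iff[THEN iffD2]) (auto simp: \<sigma>_def)
  have \<sigma>N: "N k \<le> \<sigma> k" for k
    using member_le_sum[of k "{..k}" "\<lambda>i. Suc (N i)"] by (simp add: \<sigma>_def)
  define d where "d k x = \<bar>f (\<sigma> (Suc k)) x - f (\<sigma> k) x\<bar>" for k x
  have [measurable]: "d k \<in> borel_measurable M" for k unfolding d_def by measurable
  have dk: "(\<integral>\<^sup>+x. ennreal (d k x) \<partial>M) \<le> ennreal ((1/2) ^ k)" for k
    unfolding d_def using \<sigma>N[of k] strict_mono_less_eq[OF mono, of k "Suc k"] by (intro N) auto
  have "(\<integral>\<^sup>+x. (\<Sum>k. ennreal (d k x)) \<partial>M) = (\<Sum>k. \<integral>\<^sup>+x. ennreal (d k x) \<partial>M)"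
    by (intro nn_integral_suminf) measurable
  also have "\<dots> \<le> (\<Sum>k. ennreal ((1/2) ^ k))" by (intro suminf_le dk) auto
  also have "\<dots> = ennreal (\<Sum>k. (1/2) ^ k)" by (intro suminf_ennreal2 summable_geometric) auto
  finally have "(\<integral>\<^sup>+x. (\<Sum>k. ennreal (d k x)) \<partial>M) \<noteq> \<infinity>"
    by (auto simp: top_unique)
  then have "AE x in M. (\<Sum>k. ennreal (d k x)) \<noteq> \<infinity>"
    by (intro nn_integral_PInf_AE) auto
  then have AE: "AE x in M. (\<lambda>n. f (\<sigma> n) x) \<longlonglongrightarrow> lim (\<lambda>n. f (\<sigma> n) x)"
  proof eventually_elim
    case (elim x)
    then have "summable (\<lambda>k. d k x)"
      by (intro summable_suminf_not_top) (auto simp: d_def)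
    then have "summable (\<lambda>k. f (\<sigma> (Suc k)) x - f (\<sigma> k) x)"
      unfolding d_def by (rule summable_rabs_cancel)
    moreover have telescope: "(\<Sum>k<n. f (\<sigma> (Suc k)) x - f (\<sigma> k) x) = f (\<sigma> n) x - f (\<sigma> 0) x" for n
      by (rule sum_lessThan_telescope)
    ultimately have "convergent (\<lambda>n. \<Sum>k<n. f (\<sigma> (Suc k)) x - f (\<sigma> k) x)"
      by (simp add: summable_iff_convergent)
    then have "convergent (\<lambda>n. f (\<sigma> n) x - f (\<sigma> 0) x)"
      unfolding telescope .
    then have "convergent (\<lambda>n. f (\<sigma> n) x - f (\<sigma> 0) x + f (\<sigma> 0) x)"
      by (intro convergent_add convergent_const)
    then show ?case by (simp add: convergent_LIMSEQ_iff)
  qed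
  have "(\<lambda>x. lim (\<lambda>n. f (\<sigma> n) x)) \<in> borel_measurable M" by measurable
  from that[OF this mono AE] show thesis .
qed

lemma powr_diff_le:
  fixes a b q Q :: real
  assumes "0 \<le> q" "q \<le> Q"
  shows "\<bar>a - b\<bar> powr q \<le> 2 powr Q * (\<bar>a\<bar> powr q + \<bar>b\<bar> powr q)"
proof -
  have "\<bar>a - b\<bar> \<le> 2 * max \<bar>a\<bar> \<bar>b\<bar>" by linarith
  then have "\<bar>a - b\<bar> powr q \<le> (2 * max \<bar>a\<bar> \<bar>b\<bar>) powr q" using assms by (intro powr_mono2) auto
  also have "\<dots> = 2 powr q * max \<bar>a\<bar> \<bar>b\<bar> powr q" by (simp add: powr_mult)
  also have "\<dots> \<le> 2 powr Q * (\<bar>a\<bar> powr q + \<bar>b\<bar> powr q)"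
    using assms by (intro mult_mono powr_mono) (auto simp: max_def)
  finally show ?thesis .
qed

text \<open>
  A Vitali-type argument.  By Fatou's lemma the higher power of the limit is bounded as well, so the
  differences \<open>w\<close> have bounded integrals of \<open>w^(r + \<eta>)\<close>.  Truncation at height \<open>t\<close> gives
  \<open>w^r \<le> (min w t)^r + t^(-\<eta>) w^(r + \<eta>)\<close>: the second term is uniformly small for large \<open>t\<close>, the first
  tends to 0 by dominated convergence because the measure is finite.
\<close>

lemma modular_tendsto_0_of_AE:
  fixes f :: "nat \<Rightarrow> 'a \<Rightarrow> real"
  assumes fm [measurable]: "\<And>n. f n \<in> borel_measurable M" "v \<in> borel_measurable M" "r \<in> borel_measurable M"
    and fin: "emeasure M (space M) < \<infinity>"
    and r: "\<And>x. x \<in> space M \<Longrightarrow> 1 \<le> r x" "\<And>x. x \<in> space M \<Longrightarrow> r x \<le> R" and \<eta>: "0 < \<eta>"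
    and bound: "\<And>n. (\<integral>\<^sup>+x. ennreal (\<bar>f n x\<bar> powr (r x + \<eta>)) \<partial>M) \<le> ennreal C" and C: "0 \<le> C"
    and conv: "AE x in M. (\<lambda>n. f n x) \<longlonglongrightarrow> v x"
  shows "(\<integral>\<^sup>+x. ennreal (\<bar>v x\<bar> powr r x) \<partial>M) < \<infinity>"
    and "0 < e \<Longrightarrow> \<forall>\<^sub>F n in sequentially. (\<integral>\<^sup>+x. ennreal (\<bar>f n x - v x\<bar> powr r x) \<partial>M) \<le> ennreal e"
proof -
  have "(\<integral>\<^sup>+x. ennreal (\<bar>v x\<bar> powr (r x + \<eta>)) \<partial>M)
      = (\<integral>\<^sup>+x. liminf (\<lambda>n. ennreal (\<bar>f n x\<bar> powr (r x + \<eta>))) \<partial>M)"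
  proof (rule nn_integral_cong_AE)
    show "AE x in M. ennreal (\<bar>v x\<bar> powr (r x + \<eta>)) = liminf (\<lambda>n. ennreal (\<bar>f n x\<bar> powr (r x + \<eta>)))"
      using conv AE_space
    proof eventually_elim
      case (elim x)
      have "(\<lambda>n. \<bar>f n x\<bar> powr (r x + \<eta>)) \<longlonglongrightarrow> \<bar>v x\<bar> powr (r x + \<eta>)"
        using elim r(1)[of x] \<eta> by (intro tendsto_powr' tendsto_intros) auto
      then show ?case by (intro lim_imp_Liminf[symmetric] tendsto_ennrealI) auto
    qed
  qed
  also have "\<dots> \<le> liminf (\<lambda>n. \<integral>\<^sup>+x. ennreal (\<bar>f n x\<bar> powr (r x + \<eta>)) \<partial>M)"
    by (intro nn_integral_liminf) measurable
  also have "\<dots> \<le> liminf (\<lambda>n::nat. ennreal C)"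
    using bound by (intro Liminf_mono always_eventually) auto
  also have "\<dots> = ennreal C" by (simp add: Liminf_const)
  finally have vq: "(\<integral>\<^sup>+x. ennreal (\<bar>v x\<bar> powr (r x + \<eta>)) \<partial>M) \<le> ennreal C" .
  have "(\<integral>\<^sup>+x. ennreal (\<bar>v x\<bar> powr r x) \<partial>M) \<le> (\<integral>\<^sup>+x. 1 + ennreal (\<bar>v x\<bar> powr (r x + \<eta>)) \<partial>M)"
  proof (intro nn_integral_mono)
    fix x assume x: "x \<in> space M"
    have "\<bar>v x\<bar> powr r x \<le> 1 + \<bar>v x\<bar> powr (r x + \<eta>)"
    proof (cases "\<bar>v x\<bar> \<le> 1")
      case True
      then have "\<bar>v x\<bar> powr r x \<le> 1" using r(1)[OF x] by (intro powr_le1) auto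
      then show ?thesis by (simp add: add_increasing2)
    next
      case False
      then have "\<bar>v x\<bar> powr r x \<le> \<bar>v x\<bar> powr (r x + \<eta>)" using \<eta> by (intro powr_mono) auto
      then show ?thesis by simp
    qed
    from ennreal_leI[OF this] show "ennreal (\<bar>v x\<bar> powr r x) \<le> 1 + ennreal (\<bar>v x\<bar> powr (r x + \<eta>))" by simp
  qed
  also have "\<dots> = emeasure M (space M) + (\<integral>\<^sup>+x. ennreal (\<bar>v x\<bar> powr (r x + \<eta>)) \<partial>M)"
    by (subst nn_integral_add) auto
  also have "\<dots> < \<infinity>" using fin vq by (simp add: ennreal_add_less_top le_less_trans[OF vq])
  finally show "(\<integral>\<^sup>+x. ennreal (\<bar>v x\<bar> powr r x) \<partial>M) < \<infinity>" .

  assume e: "0 < e"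
  define w where "w n x = \<bar>f n x - v x\<bar>" for n x
  have [measurable]: "w n \<in> borel_measurable M" for n unfolding w_def by measurable
  define D where "D = 2 powr (R + \<eta>) * (2 * C)"
  have D: "0 \<le> D" using C by (simp add: D_def)
  have wq: "(\<integral>\<^sup>+x. ennreal (w n x powr (r x + \<eta>)) \<partial>M) \<le> ennreal D" for n
  proof -
    have "(\<integral>\<^sup>+x. ennreal (w n x powr (r x + \<eta>)) \<partial>M)
       \<le> (\<integral>\<^sup>+x. ennreal (2 powr (R + \<eta>)) * (ennreal (\<bar>f n x\<bar> powr (r x + \<eta>)) + ennreal (\<bar>v x\<bar> powr (r x + \<eta>))) \<partial>M)"
    proof (intro nn_integral_mono)
      fix x assume x: "x \<in> space M"
      have "w n x powr (r x + \<eta>) \<le> 2 powr (R + \<eta>) * (\<bar>f n x\<bar> powr (r x + \<eta>) + \<bar>v x\<bar> powr (r x + \<eta>))"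
        unfolding w_def using r[OF x] \<eta> by (intro powr_diff_le) auto
      from ennreal_leI[OF this]
      show "ennreal (w n x powr (r x + \<eta>)) \<le>
          ennreal (2 powr (R + \<eta>)) * (ennreal (\<bar>f n x\<bar> powr (r x + \<eta>)) + ennreal (\<bar>v x\<bar> powr (r x + \<eta>)))"
        by (simp add: ennreal_mult)
    qed
    also have "\<dots> = ennreal (2 powr (R + \<eta>)) *
        ((\<integral>\<^sup>+x. ennreal (\<bar>f n x\<bar> powr (r x + \<eta>)) \<partial>M) + (\<integral>\<^sup>+x. ennreal (\<bar>v x\<bar> powr (r x + \<eta>)) \<partial>M))"
      by (subst nn_integral_cmult) (auto simp: nn_integral_add)
    also have "\<dots> \<le> ennreal (2 powr (R + \<eta>)) * (ennreal C + ennreal C)"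
      using bound[of n] vq by (intro mult_left_mono add_mono) auto
    also have "\<dots> = ennreal D"
      using C by (simp add: D_def ennreal_mult[symmetric] flip: ennreal_plus)
    finally show ?thesis .
  qed
  \<comment> \<open>The height at which the part above the truncation contributes at most \<open>e / 2\<close>.\<close>
  define t where "t = max 1 ((2 * D / e) powr (1 / \<eta>))"
  have t1: "1 \<le> t" by (simp add: t_def)
  have "2 * D / e = ((2 * D / e) powr (1 / \<eta>)) powr \<eta>"
    using D e \<eta> by (simp add: powr_powr)
  also have "\<dots> \<le> t powr \<eta>" using \<eta> by (intro powr_mono2) (auto simp: t_def)
  finally have t: "t powr - \<eta> * D \<le> e / 2"
    using t1 e by (simp add: powr_minus field_simps)
  have "(\<lambda>n. \<integral>\<^sup>+x. ennreal (min (w n x) t powr r x) \<partial>M) \<longlonglongrightarrow> (\<integral>\<^sup>+x. 0 \<partial>M)"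
  proof (rule nn_integral_dominated_convergence[where w = "\<lambda>x. ennreal (t powr R)"])
    show "AE x in M. ennreal (min (w n x) t powr r x) \<le> ennreal (t powr R)" for n
    proof (rule AE_I2)
      fix x assume x: "x \<in> space M"
      have "min (w n x) t powr r x \<le> t powr r x" using r(1)[OF x] t1 by (intro powr_mono2) (auto simp: w_def)
      also have "\<dots> \<le> t powr R" using r(2)[OF x] t1 by (intro powr_mono) auto
      finally show "ennreal (min (w n x) t powr r x) \<le> ennreal (t powr R)" by (rule ennreal_leI)
    qed
    show "(\<integral>\<^sup>+x. ennreal (t powr R) \<partial>M) < \<infinity>" using fin by (simp add: ennreal_mult_less_top)
    show "AE x in M. (\<lambda>n. ennreal (min (w n x) t powr r x)) \<longlonglongrightarrow> 0"
      using conv AE_space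
    proof eventually_elim
      case (elim x)
      have "(\<lambda>n. min (w n x) t) \<longlonglongrightarrow> min \<bar>v x - v x\<bar> t"
        unfolding w_def using elim by (intro tendsto_intros)
      then have "(\<lambda>n. min (w n x) t) \<longlonglongrightarrow> 0" using t1 by simp
      then have "(\<lambda>n. min (w n x) t powr r x) \<longlonglongrightarrow> 0"
        using r(1)[of x] elim t1 by (intro tendsto_zero_powrI[where b = "r x"]) (auto simp: w_def)
      then show ?case using tendsto_ennrealI[of _ 0] by fastforce
    qed
  qed measurable
  then have "\<forall>\<^sub>F n in sequentially. (\<integral>\<^sup>+x. ennreal (min (w n x) t powr r x) \<partial>M) < ennreal (e / 2)"
    using e by (intro order_tendstoD(2)[of _ 0]) auto
  then show "\<forall>\<^sub>F n in sequentially. (\<integral>\<^sup>+x. ennreal (\<bar>f n x - v x\<bar> powr r x) \<partial>M) \<le> ennreal e"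
  proof eventually_elim
    case (elim n)
    have "(\<integral>\<^sup>+x. ennreal (\<bar>f n x - v x\<bar> powr r x) \<partial>M)
       \<le> (\<integral>\<^sup>+x. ennreal (min (w n x) t powr r x) + ennreal (t powr - \<eta>) * ennreal (w n x powr (r x + \<eta>)) \<partial>M)"
    proof (intro nn_integral_mono)
      fix x
      have "w n x powr r x \<le> min (w n x) t powr r x + t powr - \<eta> * w n x powr (r x + \<eta>)"
      proof (cases "w n x \<le> t")
        case True
        then show ?thesis by simp
      next
        case False
        have "w n x powr r x = w n x powr - \<eta> * w n x powr (r x + \<eta>)"
          by (simp add: powr_add[symmetric])
        also have "\<dots> \<le> t powr - \<eta> * w n x powr (r x + \<eta>)"
          using False t1 \<eta> by (intro mult_right_mono powr_mono2') auto
        finally show ?thesis by (simp add: add_increasing)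
      qed
      from ennreal_leI[OF this]
      show "ennreal (\<bar>f n x - v x\<bar> powr r x) \<le> ennreal (min (w n x) t powr r x) + ennreal (t powr - \<eta>) * ennreal (w n x powr (r x + \<eta>))"
        by (simp add: ennreal_mult w_def)
    qed
    also have "\<dots> = (\<integral>\<^sup>+x. ennreal (min (w n x) t powr r x) \<partial>M) + ennreal (t powr - \<eta>) * (\<integral>\<^sup>+x. ennreal (w n x powr (r x + \<eta>)) \<partial>M)"
      by (subst nn_integral_add) (auto simp: nn_integral_cmult)
    also have "\<dots> \<le> ennreal (e / 2) + ennreal (t powr - \<eta>) * ennreal D"
      using elim wq[of n] by (intro add_mono mult_left_mono) auto
    also have "\<dots> = ennreal (e / 2 + t powr - \<eta> * D)"
      using e D by (simp add: ennreal_mult)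
    also have "\<dots> \<le> ennreal e" using t by (intro ennreal_leI) linarith
    finally show ?case .
  qed
qed

section \<open>Gagliardo densities of normalised functions\<close>

text \<open>
  The number \<open>pmax\<close> is any upper bound of the exponent; keeping it as a parameter separates the
  estimates from suprema.
\<close>

locale subcritical_exponent =
  fixes s :: real and p :: "(real^'n) \<times> (real^'n) \<Rightarrow> real" and pmax :: real
  assumes s_pos: "0 < s"
    and p_gt_1: "1 < p z"
    and p_le: "p z \<le> pmax"
    and ucont: "uniformly_continuous_on UNIV p"
    and subcritical: "s * pmax < real CARD('n)"
begin

definition gagliardo_density :: "(real^'n \<Rightarrow> real) \<Rightarrow> real^'n \<Rightarrow> ennreal" where
  "gagliardo_density u y =
     (\<integral>\<^sup>+x. ennreal (\<bar>u x - u y\<bar> powr p (x, y) / norm (x - y) powr (real CARD('n) + s * p (x, y))) \<partial>lebesgue)"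

text \<open>
  This set contains the open unit ball of the Sobolev norm (\<open>scaled_in_modular_ball\<close>); all estimates
  are made uniformly over it and transferred to norms by scaling.
\<close>

definition modular_ball :: "(real^'n \<Rightarrow> real) set" where
  "modular_ball = {u \<in> borel_measurable lebesgue.
     (\<integral>\<^sup>+x. ennreal (\<bar>u x\<bar> powr p (x, x)) \<partial>lebesgue) \<le> 1 \<and>
     (\<integral>\<^sup>+x. gagliardo_density u x \<partial>lebesgue) \<le> 1}"

lemma p_section_borel [measurable]: "(\<lambda>x. p (x, y)) \<in> borel_measurable borel"
  by (intro borel_measurable_continuous_onI continuous_on_compose2
       [OF uniformly_continuous_imp_continuous[OF ucont]] continuous_intros) auto

lemma p_diag_cont: "continuous_on A (\<lambda>x. p (x, x))"
  by (intro continuous_on_compose2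
       [OF uniformly_continuous_imp_continuous[OF ucont]] continuous_intros) auto

lemma p_diag_borel [measurable]: "(\<lambda>x. p (x, x)) \<in> borel_measurable borel"
  by (intro borel_measurable_continuous_onI p_diag_cont)

text \<open>
  At least half of the ball consists of points \<open>y\<close> with \<open>\<bar>u y\<bar> \<le> l\<close>, hence \<open>\<bar>u y - u x\<bar> \<ge> l\<close>.  As
  \<open>l \<ge> 1\<close> and \<open>\<rho> \<le> 1\<close>, replacing the exponent by its lower bound \<open>P\<close> decreases both \<open>l^p\<close> and
  \<open>\<rho>^(-(N + s p))\<close>, so the kernel is at least \<open>l^P \<rho>^(-(N + s P))\<close> there; the volume of the ball
  cancels the factor \<open>\<rho>^(-N)\<close>.
\<close>

lemma gagliardo_density_ge:
  fixes u :: "real^'n \<Rightarrow> real"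
  assumes u [measurable]: "u \<in> borel_measurable lebesgue"
    and \<rho>: "0 < \<rho>" "\<rho> \<le> 1" and l: "1 \<le> l" "2 * l \<le> \<bar>u x\<bar>"
    and P: "0 < P" "\<And>y. dist x y < \<rho> \<Longrightarrow> P \<le> p (y, x)"
    and half: "emeasure lebesgue {y \<in> ball x \<rho>. l < \<bar>u y\<bar>} \<le> ennreal (unit_ball_vol (real CARD('n)) / 2 * \<rho> ^ CARD('n))"
  shows "ennreal (unit_ball_vol (real CARD('n)) / 2 * l powr P * \<rho> powr - (s * P)) \<le> gagliardo_density u x"
proof -
  define E where "E = {y \<in> ball x \<rho>. \<bar>u y\<bar> \<le> l}"
  define A where "A = {y \<in> ball x \<rho>. l < \<bar>u y\<bar>}"
  define k where "k = l powr P * \<rho> powr - (real CARD('n) + s * P)"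
  have "{y \<in> space lebesgue. \<bar>u y\<bar> \<le> l} \<in> sets lebesgue" "{y \<in> space lebesgue. l < \<bar>u y\<bar>} \<in> sets lebesgue"
    by measurable
  then have level: "{y. \<bar>u y\<bar> \<le> l} \<in> sets lebesgue" "{y. l < \<bar>u y\<bar>} \<in> sets lebesgue" by simp_all
  have EA [measurable]: "E \<in> sets lebesgue" "A \<in> sets lebesgue"
    using sets.Int[OF fmeasurableD[OF lmeasurable_ball[of x \<rho>]] level(1)]
      sets.Int[OF fmeasurableD[OF lmeasurable_ball[of x \<rho>]] level(2)]
    by (simp_all add: E_def A_def Int_def)
  have "E \<union> A = ball x \<rho>" by (auto simp: E_def A_def)
  then have "ennreal (unit_ball_vol (real CARD('n)) * \<rho> ^ CARD('n)) = emeasure lebesgue (E \<union> A)"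
    using emeasure_ball_lebesgue[of \<rho> x] \<rho> by simp
  also have "\<dots> = emeasure lebesgue E + emeasure lebesgue A"
    by (rule plus_emeasure[OF EA, symmetric]) (auto simp: E_def A_def)
  also have "\<dots> \<le> emeasure lebesgue E + ennreal (unit_ball_vol (real CARD('n)) / 2 * \<rho> ^ CARD('n))"
    using half unfolding A_def by (intro add_left_mono)
  finally have "ennreal (unit_ball_vol (real CARD('n)) * \<rho> ^ CARD('n)) - ennreal (unit_ball_vol (real CARD('n)) / 2 * \<rho> ^ CARD('n)) \<le> emeasure lebesgue E"
    by (simp add: ennreal_minus_le_iff add.commute)
  moreover have "ennreal (unit_ball_vol (real CARD('n)) * \<rho> ^ CARD('n)) - ennreal (unit_ball_vol (real CARD('n)) / 2 * \<rho> ^ CARD('n)) = ennreal (unit_ball_vol (real CARD('n)) / 2 * \<rho> ^ CARD('n))"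
    using \<rho> by (subst ennreal_minus) (auto simp: field_simps)
  ultimately have E: "ennreal (unit_ball_vol (real CARD('n)) / 2 * \<rho> ^ CARD('n)) \<le> emeasure lebesgue E" by simp
  have ptw: "ennreal k * indicator E y \<le>
      ennreal (\<bar>u y - u x\<bar> powr p (y, x) / norm (y - x) powr (real CARD('n) + s * p (y, x)))" for y
  proof (cases "y \<in> E")
    case True
    then have y: "dist x y < \<rho>" "\<bar>u y\<bar> \<le> l" by (auto simp: E_def)
    have ul: "l \<le> \<bar>u y - u x\<bar>" using y l by linarith
    have "y \<noteq> x" using y l by auto
    then have n0: "0 < norm (y - x)" by simp
    have n1: "norm (y - x) \<le> \<rho>" using y by (simp add: dist_norm norm_minus_commute)
    note Py = P(2)[OF y(1)]
    have "norm (y - x) powr (real CARD('n) + s * p (y, x)) \<le> \<rho> powr (real CARD('n) + s * p (y, x))"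
      using n0 n1 s_pos P Py by (intro powr_mono2) auto
    also have "\<dots> \<le> \<rho> powr (real CARD('n) + s * P)"
      using \<rho> Py s_pos by (intro powr_mono') auto
    finally have den: "norm (y - x) powr (real CARD('n) + s * p (y, x)) \<le> \<rho> powr (real CARD('n) + s * P)" .
    have "l powr P \<le> l powr p (y, x)" using l Py by (intro powr_mono) auto
    also have "\<dots> \<le> \<bar>u y - u x\<bar> powr p (y, x)" using ul l P Py by (intro powr_mono2) auto
    finally have num: "l powr P \<le> \<bar>u y - u x\<bar> powr p (y, x)" .
    have "k = l powr P / \<rho> powr (real CARD('n) + s * P)"
      unfolding k_def by (simp only: powr_minus divide_inverse)
    also have "\<dots> \<le> \<bar>u y - u x\<bar> powr p (y, x) / norm (y - x) powr (real CARD('n) + s * p (y, x))"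
      using num den n0 by (intro frac_le) auto
    finally show ?thesis using True by (simp add: ennreal_leI)
  qed auto
  have "unit_ball_vol (real CARD('n)) / 2 * l powr P * \<rho> powr - (s * P) = k * (unit_ball_vol (real CARD('n)) / 2 * \<rho> ^ CARD('n))"
  proof -
    have "\<rho> powr - (real CARD('n) + s * P) * \<rho> ^ CARD('n) = \<rho> powr - (s * P)"
      unfolding powr_realpow[OF \<rho>(1), symmetric] powr_add[symmetric] by simp
    then show ?thesis unfolding k_def by (simp add: mult_ac)
  qed
  moreover have "ennreal (k * (unit_ball_vol (real CARD('n)) / 2 * \<rho> ^ CARD('n))) = ennreal k * ennreal (unit_ball_vol (real CARD('n)) / 2 * \<rho> ^ CARD('n))"
    using \<rho> by (intro ennreal_mult) (auto simp: k_def)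
  ultimately have "ennreal (unit_ball_vol (real CARD('n)) / 2 * l powr P * \<rho> powr - (s * P)) = ennreal k * ennreal (unit_ball_vol (real CARD('n)) / 2 * \<rho> ^ CARD('n))"
    by (rule trans[OF arg_cong[where f = ennreal]])
  also have "\<dots> \<le> ennreal k * emeasure lebesgue E" using E by (intro mult_left_mono) auto
  also have "\<dots> = (\<integral>\<^sup>+y. ennreal k * indicator E y \<partial>lebesgue)"
    by (subst nn_integral_cmult_indicator) auto
  also have "\<dots> \<le> gagliardo_density u x"
    unfolding gagliardo_density_def by (intro nn_integral_mono ptw)
  finally show ?thesis .
qed

section \<open>Exponents between the given and the critical one\<close>

text \<open>
  The parameter is the remaining fraction of the distance to the critical exponent: 1 gives the
  diagonal exponent \<open>p (x, x)\<close> and 0 the critical exponent.  In this parametrisation an improvement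
  step multiplies the parameter by a factor below 1, uniformly in the point.
\<close>

definition interp_exp :: "real \<Rightarrow> real^'n \<Rightarrow> real" where
  "interp_exp \<kappa> x = crit_exp s p x - \<kappa> * (crit_exp s p x - p (x, x))"

definition crit_max :: real where "crit_max = real CARD('n) * pmax / (real CARD('n) - s * pmax)"

lemma sp_less: "s * p z < real CARD('n)"
  using mult_left_mono[OF p_le[of z] less_imp_le[OF s_pos]] subcritical by linarith

text \<open>
  The critical exponent is the fixed point of the map by which one improvement step moves exponents.
\<close>

lemma crit_exp_eq: "p (x, x) + s * p (x, x) / real CARD('n) * crit_exp s p x = crit_exp s p x"
  using sp_less[of "(x, x)"] by (simp add: crit_exp_def field_simps)

lemma crit_exp_le: "crit_exp s p x \<le> crit_max"
  unfolding crit_exp_def crit_max_def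
  using p_le[of "(x,x)"] p_gt_1[of "(x,x)"] subcritical mult_left_mono[OF p_le[of "(x, x)"], of s] s_pos
  by (intro frac_le) auto

text \<open>
  A gap that is uniform in the point: it gives the improvement step room for the losses caused by the
  oscillation of the exponents.
\<close>

lemma crit_exp_gap: "s / real CARD('n) \<le> crit_exp s p x - p (x, x)"
proof -
  define t where "t = p (x, x)"
  have t: "1 < t" "s * t < real CARD('n)" using p_gt_1 sp_less by (auto simp: t_def)
  have "s / real CARD('n) \<le> s * t * t / (real CARD('n) - s * t)"
  proof (rule frac_le)
    show "s \<le> s * t * t" using t s_pos
      by (metis less_1_mult less_eq_real_def mult.assoc mult.right_neutral mult_left_mono)
  qed (use t s_pos in auto)
  also have "s * t * t / (real CARD('n) - s * t) = crit_exp s p x - p (x, x)"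
    unfolding crit_exp_def t_def[symmetric] using t by (simp add: field_simps)
  finally show ?thesis .
qed

lemma gap_pos: "0 < crit_exp s p x - p (x, x)"
  by (rule less_le_trans[OF _ crit_exp_gap]) (use s_pos in simp)

lemma interp_exp_ge: "\<kappa> \<le> 1 \<Longrightarrow> p (x, x) \<le> interp_exp \<kappa> x"
  unfolding interp_exp_def
  using mult_right_mono[OF _ less_imp_le[OF gap_pos[of x]], of \<kappa> 1] by simp

lemma interp_exp_le: "0 \<le> \<kappa> \<Longrightarrow> interp_exp \<kappa> x \<le> crit_max"
  unfolding interp_exp_def using gap_pos[of x] crit_exp_le[of x] by (simp add: add_increasing2 diff_le_eq)

lemma p_diag_ucont: "uniformly_continuous_on UNIV (\<lambda>x. p (x, x))"
  unfolding uniformly_continuous_on_def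
proof (intro allI impI)
  fix e :: real assume "0 < e"
  then obtain d where d: "0 < d" "\<And>x y. dist x y < d \<Longrightarrow> dist (p x) (p y) < e"
    by (rule uniformly_continuous_onE[OF ucont]) (auto simp: dist_commute)
  have "dist (p (x, x)) (p (y, y)) < e" if "dist x y < d / 2" for x y
  proof -
    have "dist (x, x) (y, y) \<le> dist x y + dist x y"
      unfolding dist_Pair_Pair by (rule sqrt_sum_squares_le_sum) auto
    then show ?thesis using that by (intro d(2)) simp
  qed
  then show "\<exists>d>0. \<forall>x\<in>UNIV. \<forall>y\<in>UNIV. dist y x < d \<longrightarrow> dist (p (y, y)) (p (x, x)) < e"
    using d(1) by (intro exI[of _ "d / 2"]) auto
qed

lemma interp_exp_ucont: "uniformly_continuous_on UNIV (interp_exp \<kappa>)"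
proof -
  let ?f = "\<lambda>t. real CARD('n) * t / (real CARD('n) - s * t) - \<kappa> * (real CARD('n) * t / (real CARD('n) - s * t) - t)"
  have "continuous_on {1..pmax} ?f"
  proof -
    have ne: "real CARD('n) - s * t \<noteq> 0" if "t \<in> {1..pmax}" for t
    proof -
      have "s * t \<le> s * pmax" using s_pos that by simp
      then show ?thesis using subcritical by linarith
    qed
    show ?thesis by (intro continuous_intros ballI ne)
  qed
  then have "uniformly_continuous_on {1..pmax} ?f"
    by (rule compact_uniformly_continuous) auto
  moreover have range: "range (\<lambda>x. p (x, x)) \<subseteq> {1..pmax}"
    using p_le less_imp_le[OF p_gt_1] by auto
  ultimately have "uniformly_continuous_on ((\<lambda>x. p (x, x)) ` UNIV) ?f"
    by (rule uniformly_continuous_on_mono)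
  from uniformly_continuous_on_compose[OF p_diag_ucont this]
  show ?thesis unfolding interp_exp_def[abs_def] crit_exp_def comp_def .
qed

lemma interp_exp_borel [measurable]: "interp_exp \<kappa> \<in> borel_measurable borel"
  by (intro borel_measurable_continuous_onI uniformly_continuous_imp_continuous interp_exp_ucont)

section \<open>Self-improvement of tail bounds\<close>

text \<open>
  Only large values are integrated, because powers are monotone in the exponent there, which makes lower
  bounds of exponents usable; both constants are uniform over normalised functions.
\<close>

definition tail_bound :: "real \<Rightarrow> bool" where
  "tail_bound \<kappa> \<longleftrightarrow> (\<exists>\<Lambda>\<ge>1. \<exists>C>0. \<forall>u\<in>modular_ball.
     (\<integral>\<^sup>+x. ennreal (\<bar>u x\<bar> powr interp_exp \<kappa> x) * indicator {x. \<Lambda> < \<bar>u x\<bar>} x \<partial>lebesgue) \<le> ennreal C)"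

lemma tail_bound_base: "tail_bound 1"
  unfolding tail_bound_def
proof (intro exI[of _ "1::real"] conjI ballI)
  fix u assume u: "u \<in> modular_ball"
  have "(\<integral>\<^sup>+x. ennreal (\<bar>u x\<bar> powr interp_exp 1 x) * indicator {x. 1 < \<bar>u x\<bar>} x \<partial>lebesgue)
     \<le> (\<integral>\<^sup>+x. ennreal (\<bar>u x\<bar> powr p (x, x)) \<partial>lebesgue)"
    by (intro nn_integral_mono) (auto simp: interp_exp_def split: split_indicator)
  also have "\<dots> \<le> ennreal 1" using u by (simp add: modular_ball_def)
  finally show "(\<integral>\<^sup>+x. ennreal (\<bar>u x\<bar> powr interp_exp 1 x) * indicator {x. 1 < \<bar>u x\<bar>} x \<partial>lebesgue)
     \<le> ennreal 1" .
qed auto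

text \<open>
  Chebyshev's inequality, localised so that \<open>Q\<close> need only bound \<open>q\<close> from below near \<open>x\<close>.
\<close>

lemma level_set_measure_le:
  assumes u [measurable]: "u \<in> borel_measurable lebesgue"
    and q [measurable]: "q \<in> borel_measurable borel"
    and int: "(\<integral>\<^sup>+x. ennreal (\<bar>u x\<bar> powr q x) * indicator {x. \<Lambda> < \<bar>u x\<bar>} x \<partial>lebesgue) \<le> ennreal C"
    and C: "0 \<le> C"
    and l: "1 \<le> l" "\<Lambda> \<le> l" and Q: "0 \<le> Q" "\<And>y. dist x y < \<rho> \<Longrightarrow> Q \<le> q y"
  shows "emeasure lebesgue {y \<in> ball (x::real^'n) \<rho>. l < \<bar>u y\<bar>} \<le> ennreal (C * l powr - Q)"
proof -
  define A where "A = {y \<in> ball x \<rho>. l < \<bar>u y\<bar>}"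
  have "{y \<in> space lebesgue. l < \<bar>u y\<bar>} \<in> sets lebesgue" by measurable
  from sets.Int[OF fmeasurableD[OF lmeasurable_ball[of x \<rho>]] this]
  have A [measurable]: "A \<in> sets lebesgue" by (simp add: A_def Int_def)
  have "ennreal (l powr Q) * emeasure lebesgue A = (\<integral>\<^sup>+y. ennreal (l powr Q) * indicator A y \<partial>lebesgue)"
    by (subst nn_integral_cmult_indicator) auto
  also have "\<dots> \<le> (\<integral>\<^sup>+x. ennreal (\<bar>u x\<bar> powr q x) * indicator {x. \<Lambda> < \<bar>u x\<bar>} x \<partial>lebesgue)"
  proof (intro nn_integral_mono)
    fix y
    show "ennreal (l powr Q) * indicator A y \<le> ennreal (\<bar>u y\<bar> powr q y) * indicator {x. \<Lambda> < \<bar>u x\<bar>} y"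
    proof (cases "y \<in> A")
      case True
      then have y: "dist x y < \<rho>" "l < \<bar>u y\<bar>" by (auto simp: A_def)
      have "l powr Q \<le> l powr q y" using l Q(2)[OF y(1)] by (intro powr_mono) auto
      also have "\<dots> \<le> \<bar>u y\<bar> powr q y" using y l Q(1) Q(2)[OF y(1)] by (intro powr_mono2) auto
      finally show ?thesis using True y l by (simp add: ennreal_leI)
    qed auto
  qed
  also note int
  finally have *: "ennreal (l powr Q) * emeasure lebesgue A \<le> ennreal C" .
  have "ennreal (l powr - Q) * ennreal (l powr Q) = 1"
    using l by (simp add: ennreal_mult[symmetric] powr_add[symmetric])
  then have "emeasure lebesgue A = ennreal (l powr - Q) * (ennreal (l powr Q) * emeasure lebesgue A)"
    by (simp add: mult.assoc[symmetric])
  also have "\<dots> \<le> ennreal (l powr - Q) * ennreal C" using * by (intro mult_left_mono) auto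
  also have "\<dots> = ennreal (C * l powr - Q)" using C by (simp add: ennreal_mult' mult.commute)
  finally show ?thesis by (simp add: A_def)
qed

text \<open>
  The exact fixed-point map would send \<open>\<kappa>\<close> to \<open>(s p / N) \<kappa>\<close>; any larger \<open>\<kappa>'\<close> leaves a positive margin
  \<open>gain\<close> between exponents, and \<open>\<eta>\<close> is an oscillation of the exponents so small that the resulting
  loss, at most \<open>\<eta> K\<close>, fits into it.
\<close>

lemma tail_bound_step:
  assumes tb: "tail_bound \<kappa>" and \<kappa>: "0 \<le> \<kappa>" "\<kappa> \<le> 1" "0 \<le> \<kappa>'" "s * pmax / real CARD('n) * \<kappa> < \<kappa>'"
  shows "tail_bound \<kappa>'"
proof -
  let ?N = "real CARD('n)" and ?w = "unit_ball_vol (real CARD('n))"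
  have N: "1 \<le> ?N" by (simp add: Suc_leI)
  have w: "0 < ?w" by simp
  from tb obtain \<Lambda> C where \<Lambda>: "1 \<le> \<Lambda>" and C: "0 < C" and int: "\<And>u. u \<in> modular_ball \<Longrightarrow>
     (\<integral>\<^sup>+x. ennreal (\<bar>u x\<bar> powr interp_exp \<kappa> x) * indicator {x. \<Lambda> < \<bar>u x\<bar>} x \<partial>lebesgue) \<le> ennreal C"
    unfolding tail_bound_def by blast
  define gain where "gain = (\<kappa>' - s * pmax / ?N * \<kappa>) * (s / ?N)"
  define K where "K = 1 + s / ?N * (pmax + crit_max)"
  have pmax1: "1 < pmax" using p_gt_1 p_le by (rule less_le_trans)
  have cm: "1 \<le> crit_max"
    using interp_exp_ge[of 0 undefined] interp_exp_le[of 0 undefined] p_gt_1[of "(undefined,undefined)"] by simp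
  have gain: "0 < gain" unfolding gain_def using \<kappa> s_pos N by (intro mult_pos_pos) auto
  have K: "0 < K" unfolding K_def using s_pos N pmax1 cm by (intro add_pos_nonneg mult_nonneg_nonneg divide_nonneg_nonneg) auto
  define \<eta> where "\<eta> = min (1/2) (gain / K)"
  have \<eta>: "0 < \<eta>" "\<eta> \<le> 1/2" "\<eta> * K \<le> gain"
    using gain K by (auto simp: \<eta>_def min_def field_simps)
  obtain d1 where d1: "0 < d1" "\<And>x y. dist x y < d1 \<Longrightarrow> dist (p x) (p y) < \<eta>"
    by (rule uniformly_continuous_onE[OF ucont \<eta>(1)]) (auto simp: dist_commute)
  obtain d2 where d2: "0 < d2" "\<And>x y. dist x y < d2 \<Longrightarrow> dist (interp_exp \<kappa> x) (interp_exp \<kappa> y) < \<eta>"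
    by (rule uniformly_continuous_onE[OF interp_exp_ucont[of \<kappa>] \<eta>(1)]) (auto simp: dist_commute)
  define \<delta> where "\<delta> = min 1 (min d1 d2)"
  have \<delta>: "0 < \<delta>" "\<delta> \<le> 1" "\<delta> \<le> d1" "\<delta> \<le> d2" using d1(1) d2(1) by (auto simp: \<delta>_def)
  have p_near: "p (x, x) - \<eta> \<le> p (y, x)" if "dist x y < \<delta>" for x y
    using d1(2)[of "(y,x)" "(x,x)"] that \<delta>(3) by (simp add: dist_Pair_Pair dist_real_def dist_commute abs_if split: if_splits)
  have q_near: "interp_exp \<kappa> x - \<eta> \<le> interp_exp \<kappa> y" if "dist x y < \<delta>" for x y
    using d2(2)[of x y] that \<delta>(4) by (simp add: dist_real_def abs_if split: if_splits)
  \<comment> \<open>The radius will satisfy \<open>\<rho>^N = C' l^(-Q)\<close>; the factor makes the level set fill at most half of the ball.\<close>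
  define C' where "C' = max 1 (2 * C / ?w)"
  have "C = ?w / 2 * (2 * C / ?w)" by (simp add: less_imp_neq[OF w, symmetric])
  also have "\<dots> \<le> ?w / 2 * C'" using w by (intro mult_left_mono) (auto simp: C'_def)
  finally have C': "1 \<le> C'" "C \<le> ?w / 2 * C'" by (simp_all add: C'_def)
  \<comment> \<open>As \<open>Q \<ge> 1/2\<close>, levels above this \<open>L\<close> make the radius smaller than \<open>\<delta>\<close>.\<close>
  define L where "L = max \<Lambda> ((C' / \<delta> ^ CARD('n))\<^sup>2)"
  have L: "1 \<le> L" "\<Lambda> \<le> L" using \<Lambda> by (auto simp: L_def)
  have Lroot: "C' / \<delta> ^ CARD('n) \<le> L powr (1/2)"
  proof -
    have "C' / \<delta> ^ CARD('n) = sqrt ((C' / \<delta> ^ CARD('n))\<^sup>2)" using C' \<delta> by simp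
    also have "\<dots> \<le> sqrt L" by (rule real_sqrt_le_mono) (simp add: L_def)
    finally show ?thesis using L by (simp add: powr_half_sqrt)
  qed
  define c where "c = ?w / 2 / C' / 2 powr crit_max"
  have c: "0 < c" using w C' by (simp add: c_def)
  have key: "ennreal c * ennreal (\<bar>u x\<bar> powr interp_exp \<kappa>' x) \<le> gagliardo_density u x"
    if u: "u \<in> modular_ball" and ux: "2 * L < \<bar>u x\<bar>" for u x
  proof -
    have um: "u \<in> borel_measurable lebesgue" using u by (simp add: modular_ball_def)
    define l where "l = \<bar>u x\<bar> / 2"
    have l: "1 \<le> l" "\<Lambda> \<le> l" "L \<le> l" using ux L by (auto simp: l_def)
    define P where "P = p (x, x) - \<eta>"
    define Q where "Q = interp_exp \<kappa> x - \<eta>"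
    have P: "1/2 \<le> P" "P \<le> pmax" using p_gt_1[of "(x,x)"] p_le[of "(x,x)"] \<eta> by (auto simp: P_def)
    have Q: "1/2 \<le> Q" "Q \<le> crit_max"
      using interp_exp_ge[OF \<kappa>(2), of x] interp_exp_le[OF \<kappa>(1), of x] p_gt_1[of "(x,x)"] \<eta> by (auto simp: Q_def)
    define \<rho> where "\<rho> = (C' * l powr - Q) powr (1 / ?N)"
    have \<rho>0: "0 < \<rho>" using C' l by (simp add: \<rho>_def)
    have \<rho>N: "\<rho> ^ CARD('n) = C' * l powr - Q"
      using \<rho>0 C' l by (simp add: powr_realpow[symmetric] \<rho>_def powr_powr)
    have "C' \<le> \<delta> ^ CARD('n) * L powr (1/2)" using Lroot \<delta>(1) by (simp add: field_simps)
    also have "\<dots> \<le> \<delta> ^ CARD('n) * l powr Q"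
    proof (intro mult_left_mono)
      have "L powr (1/2) \<le> l powr (1/2)" using l L by (intro powr_mono2) auto
      also have "\<dots> \<le> l powr Q" using l Q by (intro powr_mono) auto
      finally show "L powr (1/2) \<le> l powr Q" .
    qed (use \<delta> in auto)
    finally have "\<rho> ^ CARD('n) \<le> \<delta> ^ CARD('n)"
      unfolding \<rho>N using l by (simp add: powr_minus field_simps)
    then have \<rho>\<delta>: "\<rho> \<le> \<delta>" using \<delta>(1) by (simp add: power_mono_iff \<rho>0 less_imp_le)
    have "emeasure lebesgue {y \<in> ball x \<rho>. l < \<bar>u y\<bar>} \<le> ennreal (C * l powr - Q)"
      using q_near \<rho>\<delta> Q(1)
      by (intro level_set_measure_le[OF um interp_exp_borel int[OF u] less_imp_le[OF C] l(1,2)]) (auto simp: Q_def)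
    also have "\<dots> \<le> ennreal (?w / 2 * \<rho> ^ CARD('n))"
      unfolding \<rho>N mult.assoc[symmetric] using C' by (intro ennreal_leI mult_right_mono) auto
    finally have half: "emeasure lebesgue {y \<in> ball x \<rho>. l < \<bar>u y\<bar>} \<le> ennreal (?w / 2 * \<rho> ^ CARD('n))" .
    have G: "ennreal (?w / 2 * l powr P * \<rho> powr - (s * P)) \<le> gagliardo_density u x"
      using \<rho>0 \<rho>\<delta> \<delta>(2) l P p_near half
      by (intro gagliardo_density_ge[OF um]) (auto simp: l_def P_def)
    have sP: "s * P / ?N \<le> 1"
      using mult_left_mono[OF P(2) less_imp_le[OF s_pos]] subcritical N by (simp add: field_simps)
    have "\<rho> powr - (s * P) = (C' * l powr - Q) powr (- (s * P / ?N))"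
      by (simp add: \<rho>_def powr_powr)
    also have "\<dots> = C' powr (- (s * P / ?N)) * l powr (s / ?N * P * Q)"
      using C' l by (simp add: powr_mult powr_powr mult_ac)
    finally have \<rho>s: "\<rho> powr - (s * P) = C' powr (- (s * P / ?N)) * l powr (s / ?N * P * Q)" .
    have C1: "1 / C' \<le> C' powr (- (s * P / ?N))"
    proof -
      have "1 / C' = C' powr (-1)" using C' by (simp add: powr_minus_divide)
      also have "\<dots> \<le> C' powr (- (s * P / ?N))" using C' sP by (intro powr_mono) auto
      finally show ?thesis .
    qed
    \<comment> \<open>The exponent gained dominates the new one: expand \<open>P = p - \<eta>\<close>, \<open>Q = q - \<eta>\<close> and use the fixed-point identity.\<close>
    have expo: "interp_exp \<kappa>' x \<le> P + s / ?N * P * Q"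
    proof -
      let ?p = "p (x, x)" and ?q = "interp_exp \<kappa> x" and ?g = "crit_exp s p x - p (x, x)"
      have "\<eta> * (1 + s / ?N * (?p + ?q)) \<le> \<eta> * K"
        unfolding K_def using \<eta>(1) p_le[of "(x,x)"] interp_exp_le[OF \<kappa>(1), of x] s_pos N
        by (intro mult_left_mono add_mono) auto
      then have e1: "\<eta> * (1 + s / ?N * (?p + ?q)) \<le> gain" using \<eta>(3) by linarith
      have "s * ?p / ?N * \<kappa> \<le> s * pmax / ?N * \<kappa>"
        using p_le[of "(x,x)"] s_pos N \<kappa>(1) by (intro mult_right_mono divide_right_mono mult_left_mono) auto
      then have "gain \<le> (\<kappa>' - s * ?p / ?N * \<kappa>) * (s / ?N)"
        unfolding gain_def using s_pos N by (intro mult_right_mono) auto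
      also have "\<dots> \<le> (\<kappa>' - s * ?p / ?N * \<kappa>) * ?g"
        using crit_exp_gap[of x] \<kappa>(4) \<open>s * ?p / ?N * \<kappa> \<le> s * pmax / ?N * \<kappa>\<close>
        by (intro mult_left_mono) auto
      finally have e2: "gain \<le> (\<kappa>' - s * ?p / ?N * \<kappa>) * ?g" .
      have e3: "?p + s * ?p / ?N * ?q = crit_exp s p x - s * ?p / ?N * \<kappa> * ?g"
        unfolding interp_exp_def right_diff_distrib using crit_exp_eq[of x] by (simp add: algebra_simps)
      have "P + s / ?N * P * Q = ?p + s * ?p / ?N * ?q - \<eta> * (1 + s / ?N * (?p + ?q)) + s / ?N * \<eta>\<^sup>2"
        unfolding P_def Q_def by (simp add: algebra_simps power2_eq_square diff_divide_distrib add_divide_distrib)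
      also have "\<dots> \<ge> ?p + s * ?p / ?N * ?q - gain" using e1 s_pos N by (simp add: add_increasing2)
      also have "?p + s * ?p / ?N * ?q - gain \<ge> interp_exp \<kappa>' x"
        unfolding e3 using e2 by (simp add: interp_exp_def algebra_simps)
      finally show ?thesis by simp
    qed
    have "c * \<bar>u x\<bar> powr interp_exp \<kappa>' x = c * 2 powr interp_exp \<kappa>' x * l powr interp_exp \<kappa>' x"
      by (simp add: l_def powr_divide)
    also have "\<dots> \<le> c * 2 powr crit_max * l powr (P + s / ?N * P * Q)"
      using c expo l interp_exp_le[OF \<kappa>(3), of x] by (intro mult_mono mult_left_mono powr_mono) auto
    also have "\<dots> = ?w / 2 * l powr P * (1 / C' * l powr (s / ?N * P * Q))"
      by (simp add: c_def powr_add)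
    also have "\<dots> \<le> ?w / 2 * l powr P * \<rho> powr - (s * P)"
      unfolding \<rho>s using C1 w by (intro mult_left_mono mult_right_mono) auto
    finally have "ennreal (c * \<bar>u x\<bar> powr interp_exp \<kappa>' x) \<le> gagliardo_density u x"
      using G by (meson ennreal_leI order_trans)
    then show ?thesis using c by (simp add: ennreal_mult)
  qed
  have bound: "(\<integral>\<^sup>+x. ennreal (\<bar>u x\<bar> powr interp_exp \<kappa>' x) * indicator {x. 2 * L < \<bar>u x\<bar>} x \<partial>lebesgue)
      \<le> ennreal (1 / c)" (is "(\<integral>\<^sup>+x. ?f x \<partial>lebesgue) \<le> _") if u: "u \<in> modular_ball" for u
  proof -
    have [measurable]: "u \<in> borel_measurable lebesgue" using u by (simp add: modular_ball_def)
    have [measurable]: "interp_exp \<kappa>' \<in> borel_measurable lebesgue" by (intro borel_imp_lebesgue interp_exp_borel)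
    have "ennreal c * (\<integral>\<^sup>+x. ?f x \<partial>lebesgue) = (\<integral>\<^sup>+x. ennreal c * ?f x \<partial>lebesgue)"
      by (intro nn_integral_cmult[symmetric]) measurable
    also have "\<dots> \<le> (\<integral>\<^sup>+x. gagliardo_density u x \<partial>lebesgue)"
      using key[OF u] by (intro nn_integral_mono) (auto split: split_indicator)
    also have "\<dots> \<le> 1" using u by (simp add: modular_ball_def)
    finally have "ennreal (1 / c) * (ennreal c * (\<integral>\<^sup>+x. ?f x \<partial>lebesgue)) \<le> ennreal (1 / c) * 1"
      by (intro mult_left_mono) auto
    then show ?thesis
      using c by (simp add: mult.assoc[symmetric] ennreal_mult[symmetric])
  qed
  have "1 \<le> 2 * L" "0 < 1 / c" using L c by auto
  with bound show ?thesis unfolding tail_bound_def by blast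
qed

text \<open>
  The midpoint \<open>\<theta>\<close> between the slope \<open>s pmax / N\<close> and 1 is an admissible factor in every step.
\<close>

lemma tail_bound_all:
  assumes "0 < \<kappa>" "\<kappa> \<le> 1"
  shows "tail_bound \<kappa>"
proof -
  define \<theta> where "\<theta> = (1 + s * pmax / real CARD('n)) / 2"
  have mid: "0 < r \<Longrightarrow> r < 1 \<Longrightarrow> 0 < (1 + r) / 2 \<and> (1 + r) / 2 < 1 \<and> r < (1 + r) / 2" for r :: real
    by auto
  have r: "s * pmax / real CARD('n) < 1" using subcritical by simp
  have r0: "0 < s * pmax / real CARD('n)"
    using s_pos less_trans[OF _ less_le_trans[OF p_gt_1 p_le]] by simp
  have \<theta>: "0 < \<theta>" "\<theta> < 1" "s * pmax / real CARD('n) < \<theta>" using mid[OF r0 r] unfolding \<theta>_def by blast+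
  have pow: "tail_bound (\<theta> ^ n)" for n
  proof (induction n)
    case (Suc n)
    have "s * pmax / real CARD('n) * \<theta> ^ n < \<theta> ^ Suc n"
      unfolding power_Suc using \<theta> by (intro mult_strict_right_mono) auto
    then show ?case using \<theta> by (intro tail_bound_step[OF Suc]) (auto simp: power_le_one simp del: power_Suc)
  qed (simp add: tail_bound_base)
  obtain n where n: "\<theta> ^ n < \<kappa>" using real_arch_pow_inv[OF assms(1) \<theta>(2)] by blast
  show ?thesis
  proof (rule tail_bound_step[OF pow[of n]])
    have "s * pmax / real CARD('n) * \<theta> ^ n \<le> 1 * \<theta> ^ n" using r \<theta> by (intro mult_right_mono) auto
    then show "s * pmax / real CARD('n) * \<theta> ^ n < \<kappa>" using n by linarith
  qed (use \<theta> assms in \<open>auto simp: power_le_one\<close>)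
qed

section \<open>From modular bounds to norm bounds\<close>

text \<open>
  A Lebesgue measurable \<open>u\<close> need not make the integrand measurable for a product of Borel measures, so
  \<open>u\<close> is first replaced by a Borel function that agrees with it almost everywhere; for almost every
  point this does not change the inner integral.
\<close>

lemma gagliardo_density_measurable:
  assumes u: "u \<in> borel_measurable lebesgue"
  shows "gagliardo_density u \<in> borel_measurable lebesgue"
proof -
  obtain v where v [measurable]: "v \<in> borel_measurable lborel" and uv: "AE x in lborel. u x = v x"
    using completion_ex_borel_measurable_real[OF u] by auto
  define g where "g w x y = ennreal (\<bar>w x - w y\<bar> powr p (x, y) / norm (x - y) powr (real CARD('n) + s * p (x, y)))"
    for w :: "real^'n \<Rightarrow> real" and x y
  have pp: "(\<lambda>z. p (snd z, fst z)) \<in> borel_measurable borel"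
    by (intro borel_measurable_continuous_onI continuous_on_compose2
       [OF uniformly_continuous_imp_continuous[OF ucont]] continuous_intros) auto
  then have [measurable]: "(\<lambda>z. p (snd z, fst z)) \<in> borel_measurable (lborel \<Otimes>\<^sub>M lborel)"
    by (simp add: lborel_prod)
  have "(\<lambda>(y, x). g v x y) \<in> borel_measurable (lborel \<Otimes>\<^sub>M lborel)"
    unfolding g_def case_prod_beta by measurable
  then have "(\<lambda>y. \<integral>\<^sup>+x. g v x y \<partial>lborel) \<in> borel_measurable lborel"
    by (rule lborel.borel_measurable_nn_integral)
  then have "(\<lambda>y. \<integral>\<^sup>+x. g v x y \<partial>lborel) \<in> borel_measurable lebesgue"
    by (rule measurable_completion)
  moreover have "AE y in lebesgue. (\<integral>\<^sup>+x. g v x y \<partial>lborel) = gagliardo_density u y"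
    using AE_completion[OF uv]
  proof eventually_elim
    case (elim y)
    have "(\<integral>\<^sup>+x. g v x y \<partial>lborel) = (\<integral>\<^sup>+x. g u x y \<partial>lborel)"
      by (rule nn_integral_cong_AE) (use uv in eventually_elim, simp add: g_def elim)
    also have "\<dots> = gagliardo_density u y"
      by (simp add: gagliardo_density_def g_def nn_integral_completion)
    finally show ?case .
  qed
  ultimately show ?thesis by (rule borel_measurable_lebesgue_AE)
qed

lemma gagliardo_density_mono:
  assumes "\<And>x y. \<bar>u x - u y\<bar> \<le> \<bar>v x - v y\<bar>"
  shows "gagliardo_density u y \<le> gagliardo_density v y"
  unfolding gagliardo_density_def using assms less_imp_le[OF less_trans[OF zero_less_one p_gt_1]]
  by (intro nn_integral_mono ennreal_leI divide_right_mono powr_mono2) auto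

lemma gagliardo_density_divide_le:
  assumes u: "u \<in> borel_measurable lebesgue" and l: "1 \<le> l"
  shows "gagliardo_density (\<lambda>x. u x / l) y \<le> ennreal (1 / l) * gagliardo_density u y"
proof -
  have [measurable]: "u \<in> borel_measurable lebesgue" by (rule u)
  have [measurable]: "(\<lambda>x. p (x, y)) \<in> borel_measurable lebesgue" "(\<lambda>x. norm (x - y)) \<in> borel_measurable (lebesgue :: (real^'n) measure)"
    by (auto intro!: borel_imp_lebesgue p_section_borel)
  let ?f = "\<lambda>u x. \<bar>u x - u y\<bar> powr p (x, y) / norm (x - y) powr (real CARD('n) + s * p (x, y))"
  have "ennreal (?f (\<lambda>x. u x / l) x) \<le> ennreal (1 / l) * ennreal (?f u x)" for x
  proof -
    have "\<bar>(u x - u y) / l\<bar> powr p (x, y) \<le> 1 / l * \<bar>u x - u y\<bar> powr p (x, y)"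
      using l less_imp_le[OF p_gt_1] by (rule powr_divide_le)
    then have "?f (\<lambda>x. u x / l) x \<le> (1 / l * \<bar>u x - u y\<bar> powr p (x, y)) / norm (x - y) powr (real CARD('n) + s * p (x, y))"
      unfolding diff_divide_distrib by (intro divide_right_mono) auto
    then have "?f (\<lambda>x. u x / l) x \<le> 1 / l * ?f u x" by simp
    then have "ennreal (?f (\<lambda>x. u x / l) x) \<le> ennreal (1 / l * ?f u x)" by (rule ennreal_leI)
    also have "\<dots> = ennreal (1 / l) * ennreal (?f u x)" using l by (intro ennreal_mult) auto
    finally show ?thesis .
  qed
  then have "gagliardo_density (\<lambda>x. u x / l) y \<le> (\<integral>\<^sup>+x. ennreal (1 / l) * ennreal (?f u x) \<partial>lebesgue)"
    unfolding gagliardo_density_def by (intro nn_integral_mono)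
  also have "\<dots> = ennreal (1 / l) * gagliardo_density u y"
    unfolding gagliardo_density_def by (intro nn_integral_cmult) measurable
  finally show ?thesis .
qed

lemma modular_Gagliardo_eq:
  assumes "0 < l"
  shows "modular_Gagliardo s p l u = (\<integral>\<^sup>+y. gagliardo_density (\<lambda>x. u x / l) y \<partial>lebesgue)"
proof -
  have "\<bar>u x / l - u y / l\<bar> powr p (x, y) = \<bar>u x - u y\<bar> powr p (x, y) / l powr p (x, y)" for x y
    unfolding diff_divide_distrib[symmetric] using assms by (simp add: powr_divide)
  then show ?thesis unfolding modular_Gagliardo_def gagliardo_density_def by simp
qed

text \<open>
  The bridge from norms to modulars.  Nonnegativity of the norm is part of the conclusion because it
  too depends on the infima ranging over nonempty sets of scalings.
\<close>

lemma scaled_in_modular_ball: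
  assumes u: "u \<in> frac_Sobolev s p" and l: "norm_W s p u < l"
  shows "(\<lambda>x. u x / l) \<in> modular_ball" "0 < l" "0 \<le> norm_W s p u"
proof -
  have um [measurable]: "u \<in> borel_measurable lebesgue" using u by (simp add: frac_Sobolev_def)
  have pm: "(\<lambda>x. p (x, x)) \<in> borel_measurable (lebesgue_on UNIV)"
    by (simp add: lebesgue_on_UNIV_eq borel_imp_lebesgue)
  have uL: "u \<in> var_Lebesgue UNIV (\<lambda>x. p (x, x))"
    using u by (simp add: var_Lebesgue_def frac_Sobolev_def lebesgue_on_UNIV_eq)
  have p1: "1 \<le> p z" for z using p_gt_1[of z] by simp
  obtain m where m: "0 \<le> m" "(\<integral>\<^sup>+y. gagliardo_density u y \<partial>lebesgue) = ennreal m"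
    using u modular_Gagliardo_eq[of 1 u]
    by (cases "\<integral>\<^sup>+y. gagliardo_density u y \<partial>lebesgue") (auto simp: frac_Sobolev_def)
  have "modular_Gagliardo s p (m + 1) u \<le> (\<integral>\<^sup>+y. ennreal (1 / (m + 1)) * gagliardo_density u y \<partial>lebesgue)"
    using m by (subst modular_Gagliardo_eq) (auto intro!: nn_integral_mono gagliardo_density_divide_le um)
  also have "\<dots> = ennreal (1 / (m + 1)) * ennreal m"
    unfolding m(2)[symmetric] by (intro nn_integral_cmult gagliardo_density_measurable um)
  also have "\<dots> = ennreal (m / (m + 1))" using m by (simp add: ennreal_mult[symmetric])
  also have "\<dots> < 1" using m by (simp add: ennreal_less_one_iff)
  finally have ne: "{k. 0 < k \<and> modular_Gagliardo s p k u < 1} \<noteq> {}"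
    using m by (auto intro!: exI[of _ "m + 1"])
  have nL: "0 \<le> norm_L UNIV (\<lambda>x. p (x, x)) u" by (rule norm_L_nonneg[OF uL pm p1])
  have nG: "0 \<le> seminorm_W s p u"
    unfolding seminorm_W_def using ne by (intro cInf_greatest) auto
  show nW: "0 \<le> norm_W s p u" using nL nG by (simp add: norm_W_def)
  then show l0: "0 < l" using l by simp
  have "norm_L UNIV (\<lambda>x. p (x, x)) u < l" using l nG by (simp add: norm_W_def)
  then have 1: "modular_L UNIV (\<lambda>x. p (x, x)) (\<lambda>x. u x / l) \<le> 1"
    by (rule modular_L_le_1_of_norm_less[OF uL pm p1])
  have "seminorm_W s p u < l" using l nL by (simp add: norm_W_def)
  then obtain k where k: "0 < k" "modular_Gagliardo s p k u < 1" "k < l"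
    using ne unfolding seminorm_W_def by (auto dest!: cInf_lessD[rotated])
  have "(\<integral>\<^sup>+y. gagliardo_density (\<lambda>x. u x / l) y \<partial>lebesgue) \<le> (\<integral>\<^sup>+y. gagliardo_density (\<lambda>x. u x / k) y \<partial>lebesgue)"
    using k by (intro nn_integral_mono gagliardo_density_mono)
      (simp add: diff_divide_distrib[symmetric] frac_le)
  also have "\<dots> \<le> 1" using k modular_Gagliardo_eq[of k u] by simp
  finally show "(\<lambda>x. u x / l) \<in> modular_ball"
    using 1 unfolding modular_ball_def by (simp add: modular_L_def lebesgue_on_UNIV_eq)
qed

text \<open>
  If \<open>l\<close> exceeds the Sobolev norm, then \<open>u / l\<close> is normalised and has modular at most \<open>C\<close>; dividing once
  more by \<open>C \<ge> 1\<close> brings the modular below 1, so the norm of \<open>u\<close> is at most \<open>C l\<close>.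
\<close>

lemma continuously_imbedded_if_modular_bounded:
  assumes \<Omega> [measurable]: "\<Omega> \<in> sets lebesgue" and hm [measurable]: "h \<in> borel_measurable lebesgue"
    and h: "\<And>x. x \<in> \<Omega> \<Longrightarrow> 1 \<le> h x" "\<And>x. x \<in> \<Omega> \<Longrightarrow> h x \<le> H"
    and C: "1 \<le> C" "\<And>u. u \<in> modular_ball \<Longrightarrow> modular_L \<Omega> h u \<le> ennreal C"
  shows "continuously_imbedded (frac_Sobolev s p) (norm_W s p) (var_Lebesgue \<Omega> h) (norm_L \<Omega> h)"
  unfolding continuously_imbedded_def
proof (intro conjI exI[of _ C] ballI subsetI)
  have hm': "h \<in> borel_measurable (lebesgue_on \<Omega>)" by (intro measurable_restrict_space1 hm)
  fix u assume u: "u \<in> frac_Sobolev s p"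
  then have um: "u \<in> borel_measurable (lebesgue_on \<Omega>)"
    by (intro measurable_restrict_space1) (simp add: frac_Sobolev_def)
  have um': "(\<lambda>x. u x / l) \<in> borel_measurable (lebesgue_on \<Omega>)" for l using um by measurable
  {
    define l where "l = norm_W s p u + 1"
    have l: "norm_W s p u < l" "1 \<le> l"
      using scaled_in_modular_ball(3)[OF u, of "norm_W s p u + 1"] by (auto simp: l_def)
    have "modular_L \<Omega> h (\<lambda>x. l * (u x / l)) \<le> ennreal (l powr H) * modular_L \<Omega> h (\<lambda>x. u x / l)"
      using h l by (intro modular_L_scale_up um' hm') auto
    also have "\<dots> \<le> ennreal (l powr H) * ennreal C"
      by (intro mult_left_mono C(2) scaled_in_modular_ball(1)[OF u l(1)]) auto
    also have "\<dots> < \<infinity>" by (simp add: ennreal_mult_less_top)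
    finally show "u \<in> var_Lebesgue \<Omega> h" using um l by (simp add: var_Lebesgue_def)
  }
  show "norm_L \<Omega> h u \<le> C * norm_W s p u"
  proof (rule field_le_epsilon)
    fix e :: real assume e: "0 < e"
    define l where "l = norm_W s p u + e / C"
    have l: "norm_W s p u < l" using e C by (simp add: l_def)
    note l0 = scaled_in_modular_ball(2)[OF u l]
    have "modular_L \<Omega> h (\<lambda>x. u x / l / C) \<le> ennreal (1 / C) * modular_L \<Omega> h (\<lambda>x. u x / l)"
      using h C by (intro modular_L_divide_le um' hm') auto
    also have "\<dots> \<le> ennreal (1 / C) * ennreal C"
      by (intro mult_left_mono C(2) scaled_in_modular_ball(1)[OF u l]) auto
    also have "\<dots> = 1" using C by (simp add: ennreal_mult[symmetric])
    finally have "norm_L \<Omega> h u \<le> C * l"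
      using l0 C by (intro norm_L_le) (auto simp: mult.commute)
    also have "\<dots> = C * norm_W s p u + e" using C by (simp add: l_def field_simps)
    finally show "norm_L \<Omega> h u \<le> C * norm_W s p u + e" .
  qed
qed (use C in auto)

section \<open>Modular bounds for subcritical exponents\<close>

lemma crit_max_pos: "0 < crit_max"
  unfolding crit_max_def using subcritical less_trans[OF _ less_le_trans[OF p_gt_1 p_le]] by (intro divide_pos_pos mult_pos_pos) auto

lemma ex_interp_exp_ge:
  assumes "0 < g"
  obtains \<kappa> where "tail_bound \<kappa>" "\<And>x. crit_exp s p x - g \<le> interp_exp \<kappa> x"
proof -
  define \<kappa> where "\<kappa> = min 1 (g / crit_max)"
  have \<kappa>: "0 < \<kappa>" "\<kappa> \<le> 1" "\<kappa> * crit_max \<le> g"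
    using assms crit_max_pos by (auto simp: \<kappa>_def min_def field_simps)
  have "crit_exp s p x - g \<le> interp_exp \<kappa> x" for x
  proof -
    have "\<kappa> * (crit_exp s p x - p (x, x)) \<le> \<kappa> * crit_max"
      using \<kappa> crit_exp_le[of x] p_gt_1[of "(x,x)"] by (intro mult_left_mono) auto
    then show ?thesis using \<kappa>(3) by (simp add: interp_exp_def)
  qed
  then show thesis using that tail_bound_all[OF \<kappa>(1,2)] by blast
qed

text \<open>
  Where \<open>\<bar>u\<bar> \<le> \<Lambda>\<close>, the power \<open>\<bar>u\<bar>^r\<close> is at most \<open>\<Lambda>^R \<bar>u\<bar>^p\<close> because \<open>p \<le> r\<close>; elsewhere the tail bound applies.
\<close>

lemma modular_bounded_global:
  assumes r: "\<And>x. p (x, x) \<le> r x" "\<And>x. r x \<le> R" "\<And>x. r x + g \<le> crit_exp s p x" and g: "0 < g"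
  obtains C where "1 \<le> C" "\<And>u. u \<in> modular_ball \<Longrightarrow> modular_L UNIV r u \<le> ennreal C"
proof -
  obtain \<kappa> where "tail_bound \<kappa>" and \<kappa>: "\<And>x. crit_exp s p x - g \<le> interp_exp \<kappa> x"
    using ex_interp_exp_ge[OF g] by blast
  then obtain \<Lambda> C where \<Lambda>: "1 \<le> \<Lambda>" and C: "0 < C" and int: "\<And>u. u \<in> modular_ball \<Longrightarrow>
     (\<integral>\<^sup>+x. ennreal (\<bar>u x\<bar> powr interp_exp \<kappa> x) * indicator {x. \<Lambda> < \<bar>u x\<bar>} x \<partial>lebesgue) \<le> ennreal C"
    unfolding tail_bound_def by blast
  have R: "0 \<le> R" using r(1,2)[of undefined] p_gt_1[of "(undefined, undefined)"] by simp
  have bound: "modular_L UNIV r u \<le> ennreal (\<Lambda> powr R + C)" if u: "u \<in> modular_ball" for u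
  proof -
    have [measurable]: "u \<in> borel_measurable lebesgue" using u by (simp add: modular_ball_def)
    have [measurable]: "interp_exp \<kappa> \<in> borel_measurable lebesgue" "(\<lambda>x. p (x, x)) \<in> borel_measurable lebesgue"
      by (intro borel_imp_lebesgue interp_exp_borel p_diag_borel)+
    let ?f = "\<lambda>x. ennreal (\<bar>u x\<bar> powr interp_exp \<kappa> x) * indicator {x. \<Lambda> < \<bar>u x\<bar>} x"
    have "modular_L UNIV r u = (\<integral>\<^sup>+x. ennreal (\<bar>u x\<bar> powr r x) \<partial>lebesgue)"
      by (simp add: modular_L_def lebesgue_on_UNIV_eq)
    also have "\<dots> \<le> (\<integral>\<^sup>+x. ennreal (\<Lambda> powr R) * ennreal (\<bar>u x\<bar> powr p (x, x)) + ?f x \<partial>lebesgue)"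
    proof (intro nn_integral_mono)
      fix x
      show "ennreal (\<bar>u x\<bar> powr r x) \<le> ennreal (\<Lambda> powr R) * ennreal (\<bar>u x\<bar> powr p (x, x)) + ?f x"
      proof (cases "\<Lambda> < \<bar>u x\<bar>")
        case True
        have "\<bar>u x\<bar> powr r x \<le> \<bar>u x\<bar> powr interp_exp \<kappa> x"
          using True \<Lambda> r(3)[of x] \<kappa>[of x] by (intro powr_mono) auto
        then have "ennreal (\<bar>u x\<bar> powr r x) \<le> ?f x" using True by (simp add: ennreal_leI)
        then show ?thesis by (simp add: add_increasing)
      next
        case False
        have "\<bar>u x\<bar> powr (r x - p (x, x)) \<le> \<Lambda> powr (r x - p (x, x))"
          using False r(1)[of x] by (intro powr_mono2) auto
        also have "\<dots> \<le> \<Lambda> powr R"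
          using \<Lambda> r(2)[of x] p_gt_1[of "(x,x)"] by (intro powr_mono) auto
        finally have "\<bar>u x\<bar> powr (r x - p (x, x)) * \<bar>u x\<bar> powr p (x, x) \<le> \<Lambda> powr R * \<bar>u x\<bar> powr p (x, x)"
          by (intro mult_right_mono) auto
        then have "\<bar>u x\<bar> powr r x \<le> \<Lambda> powr R * \<bar>u x\<bar> powr p (x, x)"
          unfolding powr_add[symmetric] by simp
        from ennreal_leI[OF this] show ?thesis by (simp add: ennreal_mult add_increasing2)
      qed
    qed
    also have "\<dots> = ennreal (\<Lambda> powr R) * (\<integral>\<^sup>+x. ennreal (\<bar>u x\<bar> powr p (x, x)) \<partial>lebesgue) + (\<integral>\<^sup>+x. ?f x \<partial>lebesgue)"
      by (subst nn_integral_add) (auto simp: nn_integral_cmult)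
    also have "\<dots> \<le> ennreal (\<Lambda> powr R) * 1 + ennreal C"
      using u int[OF u] by (intro add_mono mult_left_mono) (auto simp: modular_ball_def)
    finally show ?thesis using C by simp
  qed
  have "1 \<le> \<Lambda> powr R" using \<Lambda> R by (simp add: ge_one_powr_ge_zero)
  with C have "1 \<le> \<Lambda> powr R + C" by simp
  then show thesis using that bound by blast
qed

text \<open>
  On a set of finite measure the small values contribute at most \<open>\<Lambda>^R\<close> times its measure; this takes the
  place of the comparison with \<open>\<bar>u\<bar>^p\<close>.
\<close>

lemma modular_bounded_local:
  assumes \<Omega> [measurable]: "\<Omega> \<in> sets lebesgue" and fin: "emeasure lebesgue \<Omega> < \<infinity>"
    and r: "\<And>x. x \<in> \<Omega> \<Longrightarrow> 0 \<le> r x" "\<And>x. x \<in> \<Omega> \<Longrightarrow> r x \<le> R" "\<And>x. x \<in> \<Omega> \<Longrightarrow> r x + g \<le> crit_exp s p x" and g: "0 < g"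
  obtains C where "1 \<le> C" "\<And>u. u \<in> modular_ball \<Longrightarrow> modular_L \<Omega> r u \<le> ennreal C"
proof -
  obtain \<kappa> where "tail_bound \<kappa>" and \<kappa>: "\<And>x. crit_exp s p x - g \<le> interp_exp \<kappa> x"
    using ex_interp_exp_ge[OF g] by blast
  then obtain \<Lambda> C where \<Lambda>: "1 \<le> \<Lambda>" and C: "0 < C" and int: "\<And>u. u \<in> modular_ball \<Longrightarrow>
     (\<integral>\<^sup>+x. ennreal (\<bar>u x\<bar> powr interp_exp \<kappa> x) * indicator {x. \<Lambda> < \<bar>u x\<bar>} x \<partial>lebesgue) \<le> ennreal C"
    unfolding tail_bound_def by blast
  obtain m where m: "0 \<le> m" "emeasure lebesgue \<Omega> = ennreal m"
    using fin by (cases "emeasure lebesgue \<Omega>") auto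
  have bound: "modular_L \<Omega> r u \<le> ennreal (\<Lambda> powr R * m + C + 1)" if u: "u \<in> modular_ball" for u
  proof -
    have [measurable]: "u \<in> borel_measurable lebesgue" using u by (simp add: modular_ball_def)
    have [measurable]: "interp_exp \<kappa> \<in> borel_measurable lebesgue"
      by (intro borel_imp_lebesgue interp_exp_borel)
    let ?f = "\<lambda>x. ennreal (\<bar>u x\<bar> powr interp_exp \<kappa> x) * indicator {x. \<Lambda> < \<bar>u x\<bar>} x"
    have "modular_L \<Omega> r u = (\<integral>\<^sup>+x. ennreal (\<bar>u x\<bar> powr r x) * indicator \<Omega> x \<partial>lebesgue)"
      unfolding modular_L_def by (rule nn_integral_restrict_space) simp
    also have "\<dots> \<le> (\<integral>\<^sup>+x. ennreal (\<Lambda> powr R) * indicator \<Omega> x + ?f x \<partial>lebesgue)"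
    proof (intro nn_integral_mono)
      fix x
      show "ennreal (\<bar>u x\<bar> powr r x) * indicator \<Omega> x \<le> ennreal (\<Lambda> powr R) * indicator \<Omega> x + ?f x"
      proof (cases "x \<in> \<Omega>")
        case x: True
        show ?thesis
        proof (cases "\<Lambda> < \<bar>u x\<bar>")
          case True
          have "\<bar>u x\<bar> powr r x \<le> \<bar>u x\<bar> powr interp_exp \<kappa> x"
            using True \<Lambda> r(3)[OF x] \<kappa>[of x] by (intro powr_mono) auto
          then have "ennreal (\<bar>u x\<bar> powr r x) \<le> ?f x" using True by (simp add: ennreal_leI)
          then show ?thesis using x by (simp add: add_increasing)
        next
          case False
          have "\<bar>u x\<bar> powr r x \<le> \<Lambda> powr r x"
            using False r(1)[OF x] by (intro powr_mono2) auto
          also have "\<dots> \<le> \<Lambda> powr R"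
            using \<Lambda> r(2)[OF x] by (intro powr_mono) auto
          finally show ?thesis using x by (simp add: ennreal_leI add_increasing2)
        qed
      qed simp
    qed
    also have "\<dots> = ennreal (\<Lambda> powr R) * emeasure lebesgue \<Omega> + (\<integral>\<^sup>+x. ?f x \<partial>lebesgue)"
      by (subst nn_integral_add) (auto simp: nn_integral_cmult_indicator)
    also have "\<dots> \<le> ennreal (\<Lambda> powr R) * ennreal m + ennreal C"
      unfolding m(2) using int[OF u] by (intro add_mono) auto
    also have "\<dots> = ennreal (\<Lambda> powr R * m + C)" using m C by (simp add: ennreal_mult)
    also have "\<dots> \<le> ennreal (\<Lambda> powr R * m + C + 1)" by (intro ennreal_leI) simp
    finally show ?thesis .
  qed
  have "1 \<le> \<Lambda> powr R * m + C + 1" using m C by simp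
  then show thesis using that bound by blast
qed

section \<open>Compactness on bounded sets\<close>

lemma modular_ball_integral_bound:
  assumes u: "u \<in> modular_ball" and h: "0 < h" "h \<le> 1"
  shows "integrable (lebesgue_on (ball z h)) u"
    and "\<bar>integral\<^sup>L (lebesgue_on (ball z h)) u\<bar> \<le> unit_ball_vol (real CARD('n)) + 1"
proof -
  have um [measurable]: "u \<in> borel_measurable lebesgue" using u by (simp add: modular_ball_def)
  have [measurable]: "(\<lambda>x. p (x, x)) \<in> borel_measurable lebesgue" by (intro borel_imp_lebesgue p_diag_borel)
  have b [measurable]: "ball z h \<in> sets lebesgue" by (rule fmeasurableD[OF lmeasurable_ball])
  let ?w = "unit_ball_vol (real CARD('n))"
  have "(\<integral>\<^sup>+y. ennreal (norm (u y)) \<partial>lebesgue_on (ball z h)) = (\<integral>\<^sup>+y. ennreal \<bar>u y\<bar> * indicator (ball z h) y \<partial>lebesgue)"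
    using b by (simp add: nn_integral_restrict_space)
  also have "\<dots> \<le> (\<integral>\<^sup>+y. indicator (ball z h) y + ennreal (\<bar>u y\<bar> powr p (y, y)) \<partial>lebesgue)"
  proof (intro nn_integral_mono)
    fix y
    have "\<bar>u y\<bar> \<le> 1 + \<bar>u y\<bar> powr p (y, y)"
    proof (cases "\<bar>u y\<bar> \<le> 1")
      case False
      then have "\<bar>u y\<bar> powr 1 \<le> \<bar>u y\<bar> powr p (y, y)" using p_gt_1[of "(y,y)"] by (intro powr_mono) auto
      then show ?thesis using False by simp
    qed (simp add: add_increasing2)
    from ennreal_leI[OF this]
    show "ennreal \<bar>u y\<bar> * indicator (ball z h) y \<le> indicator (ball z h) y + ennreal (\<bar>u y\<bar> powr p (y, y))"
      by (simp split: split_indicator)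
  qed
  also have "\<dots> = emeasure lebesgue (ball z h) + (\<integral>\<^sup>+y. ennreal (\<bar>u y\<bar> powr p (y, y)) \<partial>lebesgue)"
    using b by (subst nn_integral_add) auto
  also have "\<dots> \<le> ennreal ?w + 1"
  proof (intro add_mono)
    have "?w * h ^ CARD('n) \<le> ?w * 1" using h by (intro mult_left_mono power_le_one) auto
    then show "emeasure lebesgue (ball z h) \<le> ennreal ?w"
      using h emeasure_ball_lebesgue[of h z] by (simp add: ennreal_leI)
    show "(\<integral>\<^sup>+y. ennreal (\<bar>u y\<bar> powr p (y, y)) \<partial>lebesgue) \<le> 1" using u by (simp add: modular_ball_def)
  qed
  also have "\<dots> = ennreal (?w + 1)" by simp
  finally have *: "(\<integral>\<^sup>+y. ennreal (norm (u y)) \<partial>lebesgue_on (ball z h)) \<le> ennreal (?w + 1)" .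
  show int: "integrable (lebesgue_on (ball z h)) u"
  proof (rule integrableI_bounded)
    show "u \<in> borel_measurable (lebesgue_on (ball z h))" by (rule measurable_restrict_space1[OF um])
    show "(\<integral>\<^sup>+y. ennreal (norm (u y)) \<partial>lebesgue_on (ball z h)) < \<infinity>" using * by (rule le_less_trans) simp
  qed
  have "ennreal (norm (integral\<^sup>L (lebesgue_on (ball z h)) u)) \<le> ennreal (?w + 1)"
    using integral_norm_bound_ennreal[OF int] * by (rule order_trans)
  then show "\<bar>integral\<^sup>L (lebesgue_on (ball z h)) u\<bar> \<le> ?w + 1"
    by (subst (asm) ennreal_le_iff) auto
qed

text \<open>
  With \<open>t = 2 h\<close> a difference \<open>d = \<bar>u x - u y\<bar>\<close> is either at most \<open>t^(s/2)\<close> or satisfies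
  \<open>d \<le> t^((s/2)(1 - p)) d^p\<close>; in the second case the kernel absorbs \<open>d^p\<close> at the price of
  \<open>t^(N + s p)\<close>.  The total exponent of \<open>t\<close> is then at least \<open>N + s/2\<close>, and averaging over the ball
  removes \<open>t^N\<close>.
\<close>

lemma average_oscillation_le:
  assumes u: "u \<in> borel_measurable lebesgue" and int: "integrable (lebesgue_on (ball z h)) u"
    and h: "0 < h" "2 * h \<le> 1" and x: "dist z x < h"
  shows "ennreal \<bar>u x - integral\<^sup>L (lebesgue_on (ball z h)) u / (unit_ball_vol (real CARD('n)) * h ^ CARD('n))\<bar>
    \<le> ennreal ((2 * h) powr (s / 2)) * (1 + ennreal (2 ^ CARD('n) / unit_ball_vol (real CARD('n))) * gagliardo_density u x)"
proof -
  let ?N = "real CARD('n)"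
  define w where "w = unit_ball_vol ?N"
  define t where "t = 2 * h"
  define V where "V = w * h ^ CARD('n)"
  define I where "I = integral\<^sup>L (lebesgue_on (ball z h)) u"
  have w: "0 < w" by (simp add: w_def)
  have V: "0 < V" using w h by (simp add: V_def)
  have t: "0 < t" "t \<le> 1" using h by (auto simp: t_def)
  have b [measurable]: "ball z h \<in> sets lebesgue" by (rule fmeasurableD[OF lmeasurable_ball])
  have eb: "emeasure lebesgue (ball z h) = ennreal V" using h emeasure_ball_lebesgue[of h z] by (simp add: V_def w_def)
  have mb: "measure lebesgue (ball z h) = V" using eb V by (simp add: measure_def)
  have [measurable]: "u \<in> borel_measurable lebesgue" by (rule u)
  have [measurable]: "(\<lambda>y. p (y, x)) \<in> borel_measurable lebesgue" "(\<lambda>y. norm (y - x)) \<in> borel_measurable (lebesgue :: (real^'n) measure)"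
    by (auto intro!: borel_imp_lebesgue p_section_borel)
  let ?k = "\<lambda>y. \<bar>u y - u x\<bar> powr p (y, x) / norm (y - x) powr (?N + s * p (y, x))"
  have ptw: "\<bar>u x - u y\<bar> \<le> t powr (s / 2) + t powr (?N + s / 2) * ?k y" if y: "y \<in> ball z h" for y
  proof (cases "\<bar>u x - u y\<bar> \<le> t powr (s / 2)")
    case True
    then show ?thesis by (simp add: add_increasing2)
  next
    case False
    define d where "d = \<bar>u y - u x\<bar>"
    define P where "P = p (y, x)"
    have P: "1 < P" using p_gt_1 by (simp add: P_def)
    have d: "t powr (s / 2) < d" using False by (simp add: d_def abs_minus_commute)
    have d0: "0 < d" using d by (rule le_less_trans[rotated]) simp
    have "y \<noteq> x" using d0 by (auto simp: d_def)
    then have n0: "0 < norm (y - x)" by simp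
    have "dist y x \<le> dist z y + dist z x" by (metis dist_commute dist_triangle)
    then have n1: "norm (y - x) \<le> t" using x y by (simp add: t_def dist_norm)
    have "d = d powr (1 - P) * d powr P" using d0 by (simp add: powr_add[symmetric])
    also have "\<dots> \<le> (t powr (s / 2)) powr (1 - P) * d powr P"
      using d d0 P t by (intro mult_right_mono powr_mono2') auto
    also have "\<dots> = t powr (s / 2 * (1 - P)) * (norm (y - x) powr (?N + s * P) * ?k y)"
      using n0 by (simp add: powr_powr d_def P_def)
    also have "\<dots> \<le> t powr (s / 2 * (1 - P)) * (t powr (?N + s * P) * ?k y)"
      using n0 n1 P s_pos by (intro mult_left_mono mult_right_mono powr_mono2) auto
    also have "\<dots> = t powr (s / 2 * (1 - P) + (?N + s * P)) * ?k y"
      by (simp add: powr_add)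
    also have "\<dots> \<le> t powr (?N + s / 2) * ?k y"
    proof (intro mult_right_mono powr_mono')
      have "0 \<le> s * P" using s_pos P by simp
      moreover have "s / 2 * (1 - P) = s / 2 - s * P / 2" by (simp add: field_simps)
      ultimately show "?N + s / 2 \<le> s / 2 * (1 - P) + (?N + s * P)" by linarith
    qed (use t in auto)
    finally show ?thesis by (simp add: d_def abs_minus_commute add_increasing)
  qed
  have intd: "integrable (lebesgue_on (ball z h)) (\<lambda>y. u x - u y)"
    using int by (intro Bochner_Integration.integrable_diff) (auto simp: eb finite_measure.integrable_const finite_measure_lebesgue_on lmeasurable_ball)
  have "V * u x - I = (\<integral>y. u x - u y \<partial>lebesgue_on (ball z h))"
    unfolding I_def using int
    by (subst Bochner_Integration.integral_diff)
       (auto simp: finite_measure.integrable_const finite_measure_lebesgue_on lmeasurable_ball measure_restrict_space mb)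
  then have "ennreal \<bar>V * u x - I\<bar> \<le> (\<integral>\<^sup>+y. ennreal \<bar>u x - u y\<bar> \<partial>lebesgue_on (ball z h))"
    using integral_norm_bound_ennreal[OF intd] by simp
  also have "\<dots> = (\<integral>\<^sup>+y. ennreal \<bar>u x - u y\<bar> * indicator (ball z h) y \<partial>lebesgue)"
    using b by (simp add: nn_integral_restrict_space)
  also have "\<dots> \<le> (\<integral>\<^sup>+y. ennreal (t powr (s / 2)) * indicator (ball z h) y + ennreal (t powr (?N + s / 2)) * ennreal (?k y) \<partial>lebesgue)"
  proof (intro nn_integral_mono)
    fix y
    show "ennreal \<bar>u x - u y\<bar> * indicator (ball z h) y \<le> ennreal (t powr (s / 2)) * indicator (ball z h) y + ennreal (t powr (?N + s / 2)) * ennreal (?k y)"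
    proof (cases "y \<in> ball z h")
      case True
      have "ennreal \<bar>u x - u y\<bar> \<le> ennreal (t powr (s / 2) + t powr (?N + s / 2) * ?k y)"
        using ptw[OF True] by (rule ennreal_leI)
      also have "\<dots> = ennreal (t powr (s / 2)) + ennreal (t powr (?N + s / 2)) * ennreal (?k y)"
      proof -
        have "ennreal (t powr (?N + s / 2) * ?k y) = ennreal (t powr (?N + s / 2)) * ennreal (?k y)"
          by (rule ennreal_mult) auto
        then show ?thesis by (subst ennreal_plus) auto
      qed
      finally show ?thesis using True by simp
    qed simp
  qed
  also have "\<dots> = ennreal (t powr (s / 2)) * emeasure lebesgue (ball z h) + ennreal (t powr (?N + s / 2)) * gagliardo_density u x"
    unfolding gagliardo_density_def using b
    by (subst nn_integral_add) (auto simp: nn_integral_cmult_indicator nn_integral_cmult)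
  finally have *: "ennreal \<bar>V * u x - I\<bar> \<le> ennreal (t powr (s / 2)) * ennreal V + ennreal (t powr (?N + s / 2)) * gagliardo_density u x"
    by (simp add: eb)
  have "\<bar>u x - I / V\<bar> = 1 / V * \<bar>V * u x - I\<bar>"
    using V by (simp add: field_simps abs_if)
  then have "ennreal \<bar>u x - I / V\<bar> = ennreal (1 / V) * ennreal \<bar>V * u x - I\<bar>"
    using V by (simp only: ennreal_mult' divide_nonneg_nonneg zero_le_one less_imp_le)
  also have "\<dots> \<le> ennreal (1 / V) * (ennreal (t powr (s / 2)) * ennreal V + ennreal (t powr (?N + s / 2)) * gagliardo_density u x)"
    using * by (intro mult_left_mono) auto
  also have "\<dots> = ennreal (1 / V) * ennreal (t powr (s / 2)) * ennreal V + ennreal (1 / V) * ennreal (t powr (?N + s / 2)) * gagliardo_density u x"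
    by (simp add: distrib_left mult.assoc)
  also have "ennreal (1 / V) * ennreal (t powr (s / 2)) * ennreal V = ennreal (t powr (s / 2))"
    using V by (simp add: ennreal_mult[symmetric])
  also have "ennreal (1 / V) * ennreal (t powr (?N + s / 2)) = ennreal (t powr (s / 2)) * ennreal (2 ^ CARD('n) / w)"
  proof -
    have "1 / V * t powr (?N + s / 2) = t powr (s / 2) * (2 ^ CARD('n) / w)"
      using t h w by (simp add: V_def powr_add powr_realpow t_def power_mult_distrib)
    then show ?thesis using V w by (simp add: ennreal_mult[symmetric])
  qed
  finally show ?thesis
    unfolding I_def V_def w_def t_def by (simp add: distrib_left mult.assoc)
qed

text \<open>
  Means are compared only over balls centred in finite nets, one net for each radius, so countably many
  sequences of numbers have to converge.  Each is bounded, uniformly in the ball, because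
  \<open>\<bar>u\<bar> \<le> 1 + \<bar>u\<bar>^p\<close>.
\<close>

lemma modular_ball_L1_precompact:
  assumes u: "\<And>n. u n \<in> modular_ball" and \<Omega> [measurable]: "\<Omega> \<in> sets lebesgue" and bd: "bounded \<Omega>"
  shows "\<exists>\<sigma> :: nat \<Rightarrow> nat. strict_mono \<sigma> \<and> (\<forall>e>0. \<exists>N. \<forall>m\<ge>N. \<forall>n\<ge>N.
    (\<integral>\<^sup>+x. ennreal \<bar>u (\<sigma> m) x - u (\<sigma> n) x\<bar> \<partial>lebesgue_on \<Omega>) \<le> ennreal e)"
proof -
  let ?w = "unit_ball_vol (real CARD('n))"
  have w: "0 < ?w" by simp
  define h where "h k = 1 / (2 * real (Suc k))" for k
  have h: "0 < h k" "h k \<le> 1" "2 * h k \<le> 1" for k by (auto simp: h_def field_simps)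
  have "compact (closure \<Omega>)" using bd by simp
  then have "\<forall>e>0. \<exists>F. finite F \<and> closure \<Omega> \<subseteq> (\<Union>z\<in>F. ball z e)"
    unfolding compact_eq_totally_bounded by blast
  then have "\<exists>F. finite F \<and> \<Omega> \<subseteq> (\<Union>z\<in>F. ball z (h k))" for k
    using h(1)[of k] closure_subset[of \<Omega>] by (meson order_trans)
  then obtain F where F: "\<And>k. finite (F k)" "\<And>k. \<Omega> \<subseteq> (\<Union>z\<in>F k. ball z (h k))" by metis
  define I where "I n kz = integral\<^sup>L (lebesgue_on (ball (snd kz) (h (fst kz)))) (u n)" for n and kz :: "nat \<times> (real^'n)"
  have "countable (Sigma UNIV F)" using F(1) by (intro countable_SIGMA) (auto intro: countable_finite)
  moreover have "norm (I n kz) \<le> ?w + 1" for n kz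
    unfolding I_def real_norm_def by (rule modular_ball_integral_bound(2)[OF u h(1,2)])
  ultimately obtain \<sigma> where \<sigma>: "strict_mono (\<sigma> :: nat \<Rightarrow> nat)"
    and lim: "\<And>kz. kz \<in> Sigma UNIV F \<Longrightarrow> \<exists>l. (\<lambda>n. I (\<sigma> n) kz) \<longlonglongrightarrow> l"
    using function_convergent_subsequence[of "Sigma UNIV F" I "?w + 1"] by blast
  have fin: "\<Omega> \<in> lmeasurable" using bd \<Omega> by (rule bounded_set_imp_lmeasurable)
  define \<mu> where "\<mu> = measure lebesgue \<Omega>"
  have \<mu>: "0 \<le> \<mu>" "emeasure lebesgue \<Omega> = ennreal \<mu>"
    using fin by (auto simp: \<mu>_def emeasure_eq_measure2)
  define K where "K = 2 ^ CARD('n) / ?w"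
  have K: "0 \<le> K" using w by (simp add: K_def)
  have "\<exists>N. \<forall>m\<ge>N. \<forall>n\<ge>N. (\<integral>\<^sup>+x. ennreal \<bar>u (\<sigma> m) x - u (\<sigma> n) x\<bar> \<partial>lebesgue_on \<Omega>) \<le> ennreal e"
    if e: "0 < e" for e
  proof -
    define D where "D = 2 * \<mu> + 2 * K"
    have D: "0 \<le> D" using \<mu> K by (simp add: D_def)
    have "(\<lambda>k. (2 * h k) powr (s / 2)) \<longlonglongrightarrow> 0"
    proof (rule tendsto_zero_powrI[where b = "s / 2"])
      show "(\<lambda>k. 2 * h k) \<longlonglongrightarrow> 0"
      proof -
        have "2 * h k = inverse (real (Suc k))" for k by (simp add: h_def field_simps)
        then show ?thesis using LIMSEQ_inverse_real_of_nat by simp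
      qed
    qed (use s_pos h in \<open>auto intro!: always_eventually tendsto_const simp: less_imp_le\<close>)
    then have "(\<lambda>k. (2 * h k) powr (s / 2) * D) \<longlonglongrightarrow> 0" by (rule tendsto_mult_left_zero)
    then have "\<forall>\<^sub>F k in sequentially. (2 * h k) powr (s / 2) * D < e / 2"
      using e by (intro order_tendstoD) auto
    then obtain k where k: "(2 * h k) powr (s / 2) * D < e / 2"
      by (auto simp: eventually_sequentially)
    \<comment> \<open>The oscillation around the means costs \<open>a D\<close>, and the difference of the means \<open>b\<close> times the measure of the set.\<close>
    define a where "a = (2 * h k) powr (s / 2)"
    define V where "V = ?w * h k ^ CARD('n)"
    have V: "0 < V" using w h by (simp add: V_def)
    define b where "b = e / 2 / (\<mu> + 1)"
    have b: "0 < b" "b * \<mu> \<le> e / 2" using e \<mu> by (auto simp: b_def field_simps)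
    have "\<exists>N. \<forall>m\<ge>N. \<forall>n\<ge>N. \<bar>I (\<sigma> m) (k, z) - I (\<sigma> n) (k, z)\<bar> < b * V" if z: "z \<in> F k" for z
    proof -
      have "Cauchy (\<lambda>n. I (\<sigma> n) (k, z))" using lim[of "(k, z)"] z by (auto intro: LIMSEQ_imp_Cauchy)
      then show ?thesis using b V unfolding Cauchy_def dist_real_def by simp
    qed
    then obtain M where M: "\<And>z m n. z \<in> F k \<Longrightarrow> M z \<le> m \<Longrightarrow> M z \<le> n \<Longrightarrow> \<bar>I (\<sigma> m) (k, z) - I (\<sigma> n) (k, z)\<bar> < b * V"
      by metis
    define N where "N = Max (insert 0 (M ` F k))"
    have MN: "M z \<le> N" if "z \<in> F k" for z using that F(1)[of k] by (auto simp: N_def)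
    have "(\<integral>\<^sup>+x. ennreal \<bar>u (\<sigma> m) x - u (\<sigma> n) x\<bar> \<partial>lebesgue_on \<Omega>) \<le> ennreal e" if mn: "N \<le> m" "N \<le> n" for m n
    proof -
      let ?G = "\<lambda>n x. gagliardo_density (u (\<sigma> n)) x"
      have um: "u i \<in> borel_measurable lebesgue" for i using u[of i] by (simp add: modular_ball_def)
      note [measurable] = gagliardo_density_measurable[OF um]
      have ptw: "ennreal \<bar>u (\<sigma> m) x - u (\<sigma> n) x\<bar>
          \<le> ennreal a * (1 + ennreal K * ?G m x) + ennreal a * (1 + ennreal K * ?G n x) + ennreal b" if x: "x \<in> \<Omega>" for x
      proof -
        obtain z where z: "z \<in> F k" "dist z x < h k" using F(2)[of k] x by auto
        have osc: "ennreal \<bar>u i x - I i (k, z) / V\<bar> \<le> ennreal a * (1 + ennreal K * gagliardo_density (u i) x)" for i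
          unfolding I_def a_def V_def K_def fst_conv snd_conv
          by (rule average_oscillation_le[OF um modular_ball_integral_bound(1)[OF u h(1,2)] h(1,3) z(2)])
        have "\<bar>I (\<sigma> m) (k, z) / V - I (\<sigma> n) (k, z) / V\<bar> \<le> b"
          using M[OF z(1) order_trans[OF MN[OF z(1)] mn(1)] order_trans[OF MN[OF z(1)] mn(2)]] V
          unfolding diff_divide_distrib[symmetric] by (simp add: field_simps)
        then have "\<bar>u (\<sigma> m) x - u (\<sigma> n) x\<bar> \<le> \<bar>u (\<sigma> m) x - I (\<sigma> m) (k, z) / V\<bar> + \<bar>u (\<sigma> n) x - I (\<sigma> n) (k, z) / V\<bar> + b"
          by linarith
        then have "ennreal \<bar>u (\<sigma> m) x - u (\<sigma> n) x\<bar> \<le> ennreal (\<bar>u (\<sigma> m) x - I (\<sigma> m) (k, z) / V\<bar> + \<bar>u (\<sigma> n) x - I (\<sigma> n) (k, z) / V\<bar> + b)"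
          by (rule ennreal_leI)
        also have "\<dots> = ennreal \<bar>u (\<sigma> m) x - I (\<sigma> m) (k, z) / V\<bar> + ennreal \<bar>u (\<sigma> n) x - I (\<sigma> n) (k, z) / V\<bar> + ennreal b"
          using b by simp
        also have "\<dots> \<le> ennreal a * (1 + ennreal K * ?G m x) + ennreal a * (1 + ennreal K * ?G n x) + ennreal b"
          by (intro add_mono osc order_refl)
        finally show ?thesis .
      qed
      have G: "(\<integral>\<^sup>+x. ?G i x * indicator \<Omega> x \<partial>lebesgue) \<le> 1" for i
      proof -
        have "(\<integral>\<^sup>+x. ?G i x * indicator \<Omega> x \<partial>lebesgue) \<le> (\<integral>\<^sup>+x. ?G i x \<partial>lebesgue)"
          by (intro nn_integral_mono) (auto split: split_indicator)
        also have "\<dots> \<le> 1" using u[of "\<sigma> i"] by (simp add: modular_ball_def)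
        finally show ?thesis .
      qed
      have "(\<integral>\<^sup>+x. ennreal \<bar>u (\<sigma> m) x - u (\<sigma> n) x\<bar> \<partial>lebesgue_on \<Omega>)
         = (\<integral>\<^sup>+x. ennreal \<bar>u (\<sigma> m) x - u (\<sigma> n) x\<bar> * indicator \<Omega> x \<partial>lebesgue)"
        by (rule nn_integral_restrict_space) simp
      also have "\<dots> \<le> (\<integral>\<^sup>+x. ennreal (2 * a + b) * indicator \<Omega> x + ennreal (a * K) * (?G m x * indicator \<Omega> x) + ennreal (a * K) * (?G n x * indicator \<Omega> x) \<partial>lebesgue)"
      proof (intro nn_integral_mono)
        fix x
        have "ennreal a * (1 + ennreal K * g) + ennreal a * (1 + ennreal K * g') + ennreal b
            = ennreal (2 * a + b) + ennreal (a * K) * g + ennreal (a * K) * g'" for g g'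
        proof -
          have a0: "0 \<le> a" by (simp add: a_def)
          have "ennreal (a + a + b) = ennreal a + ennreal a + ennreal b" "ennreal (a * K) = ennreal a * ennreal K"
            using a0 b(1) K by (simp_all only: ennreal_mult ennreal_plus add_nonneg_nonneg less_imp_le)
          then have "ennreal (2 * a + b) = ennreal a + ennreal a + ennreal b" "ennreal (a * K) = ennreal a * ennreal K"
            unfolding mult_2 by blast+
          then show ?thesis by (simp add: distrib_left mult.assoc add_ac)
        qed
        then show "ennreal \<bar>u (\<sigma> m) x - u (\<sigma> n) x\<bar> * indicator \<Omega> x
           \<le> ennreal (2 * a + b) * indicator \<Omega> x + ennreal (a * K) * (?G m x * indicator \<Omega> x) + ennreal (a * K) * (?G n x * indicator \<Omega> x)"
          using ptw[of x] by (auto split: split_indicator)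
      qed
      also have "\<dots> = ennreal (2 * a + b) * emeasure lebesgue \<Omega> + ennreal (a * K) * (\<integral>\<^sup>+x. ?G m x * indicator \<Omega> x \<partial>lebesgue)
          + ennreal (a * K) * (\<integral>\<^sup>+x. ?G n x * indicator \<Omega> x \<partial>lebesgue)"
        by (simp add: nn_integral_add nn_integral_cmult nn_integral_cmult_indicator)
      also have "\<dots> \<le> ennreal (2 * a + b) * ennreal \<mu> + ennreal (a * K) * 1 + ennreal (a * K) * 1"
        unfolding \<mu>(2) by (intro add_mono mult_left_mono G) auto
      also have "\<dots> = ennreal ((2 * a + b) * \<mu> + a * K + a * K)"
      proof -
        have nn: "0 \<le> 2 * a + b" "0 \<le> (2 * a + b) * \<mu>" "0 \<le> a * K"
          using b K \<mu> by (auto simp: a_def)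
        show ?thesis
          by (simp only: mult_1_right ennreal_plus[OF add_nonneg_nonneg[OF nn(2,3)] nn(3)]
              ennreal_plus[OF nn(2,3)] ennreal_mult[OF nn(1) \<mu>(1)])
      qed
      also have "\<dots> = ennreal (a * D + b * \<mu>)" by (simp add: D_def algebra_simps)
      also have "\<dots> \<le> ennreal e" using k b by (intro ennreal_leI) (simp add: a_def)
      finally show ?thesis .
    qed
    then show ?thesis by blast
  qed
  with \<sigma> show ?thesis by blast
qed

text \<open>
  Half of the gap \<open>g\<close> is spent on raising the exponent to \<open>r + g/2\<close>, the other half on staying
  subcritical.
\<close>

lemma compactly_imbedded_bounded:
  assumes \<Omega> [measurable]: "\<Omega> \<in> sets lebesgue" and bd: "bounded \<Omega>" and rm [measurable]: "r \<in> borel_measurable lebesgue"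
    and r: "\<And>x. x \<in> \<Omega> \<Longrightarrow> 1 \<le> r x" "\<And>x. x \<in> \<Omega> \<Longrightarrow> r x \<le> R" "\<And>x. x \<in> \<Omega> \<Longrightarrow> r x + g \<le> crit_exp s p x"
    and g: "0 < g"
  shows "compactly_imbedded (frac_Sobolev s p) (norm_W s p) (var_Lebesgue \<Omega> r) (norm_L \<Omega> r)"
  unfolding compactly_imbedded_def
proof (intro conjI allI impI)
  have fin: "emeasure lebesgue \<Omega> < \<infinity>"
    using bounded_set_imp_lmeasurable[OF bd \<Omega>] by (simp add: fmeasurable_def)
  have r0: "0 \<le> r x" if "x \<in> \<Omega>" for x using r(1)[OF that] by simp
  obtain C where C: "1 \<le> C" "\<And>u. u \<in> modular_ball \<Longrightarrow> modular_L \<Omega> r u \<le> ennreal C"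
    by (rule modular_bounded_local[OF \<Omega> fin r0 r(2,3) g]) auto
  show "continuously_imbedded (frac_Sobolev s p) (norm_W s p) (var_Lebesgue \<Omega> r) (norm_L \<Omega> r)"
    by (rule continuously_imbedded_if_modular_bounded[OF \<Omega> rm r(1,2) C]) auto
  fix U :: "nat \<Rightarrow> real^'n \<Rightarrow> real"
  assume "(\<forall>n. U n \<in> frac_Sobolev s p) \<and> (\<exists>M. \<forall>n. norm_W s p (U n) \<le> M)"
  then obtain M where U: "\<And>n. U n \<in> frac_Sobolev s p" "\<And>n. norm_W s p (U n) \<le> M" by auto
  define l where "l = max M 0 + 1"
  have l: "1 \<le> l" "norm_W s p (U n) < l" for n using U(2)[of n] by (auto simp: l_def)
  define u where "u n x = U n x / l" for n x
  have u: "u n \<in> modular_ball" for n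
    using scaled_in_modular_ball(1)[OF U(1) l(2), of n] by (simp add: u_def[abs_def])
  obtain \<sigma>1 where \<sigma>1: "strict_mono (\<sigma>1 :: nat \<Rightarrow> nat)" and cauchy0:
    "\<forall>e>0. \<exists>N. \<forall>m\<ge>N. \<forall>n\<ge>N. (\<integral>\<^sup>+x. ennreal \<bar>u (\<sigma>1 m) x - u (\<sigma>1 n) x\<bar> \<partial>lebesgue_on \<Omega>) \<le> ennreal e"
    using modular_ball_L1_precompact[where u = u, OF u \<Omega> bd] by blast
  have cauchy: "\<exists>N. \<forall>m\<ge>N. \<forall>n\<ge>N. (\<integral>\<^sup>+x. ennreal \<bar>u (\<sigma>1 m) x - u (\<sigma>1 n) x\<bar> \<partial>lebesgue_on \<Omega>) \<le> ennreal e"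
    if "0 < e" for e by (rule cauchy0[THEN spec, THEN mp, OF that])
  have um [measurable]: "u n \<in> borel_measurable (lebesgue_on \<Omega>)" for n
    using u[of n] by (intro measurable_restrict_space1) (simp add: modular_ball_def)
  have rm' [measurable]: "r \<in> borel_measurable (lebesgue_on \<Omega>)" by (intro measurable_restrict_space1 rm)
  obtain v \<sigma>2 where v [measurable]: "v \<in> borel_measurable (lebesgue_on \<Omega>)" and \<sigma>2: "strict_mono \<sigma>2"
    and AE: "AE x in lebesgue_on \<Omega>. (\<lambda>n. u (\<sigma>1 (\<sigma>2 n)) x) \<longlonglongrightarrow> v x"
    by (rule L1_Cauchy_imp_AE_convergent_subseq[of "\<lambda>n. u (\<sigma>1 n)", OF um cauchy])
  define \<sigma> where "\<sigma> = \<sigma>1 \<circ> \<sigma>2"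
  have \<sigma>: "strict_mono \<sigma>" unfolding \<sigma>_def by (rule strict_mono_o[OF \<sigma>1 \<sigma>2])
  obtain C' where C': "1 \<le> C'" "\<And>u. u \<in> modular_ball \<Longrightarrow> modular_L \<Omega> (\<lambda>x. r x + g / 2) u \<le> ennreal C'"
  proof (rule modular_bounded_local[OF \<Omega> fin])
    fix x assume x: "x \<in> \<Omega>"
    show "0 \<le> r x + g / 2" "r x + g / 2 \<le> R + g / 2" "r x + g / 2 + g / 2 \<le> crit_exp s p x"
      using r(1-3)[OF x] g by auto
  qed (use g in auto)
  have fin': "emeasure (lebesgue_on \<Omega>) (space (lebesgue_on \<Omega>)) < \<infinity>"
    using fin by (simp add: emeasure_restrict_space)
  have bound: "(\<integral>\<^sup>+x. ennreal (\<bar>u (\<sigma> n) x\<bar> powr (r x + g / 2)) \<partial>lebesgue_on \<Omega>) \<le> ennreal C'" for n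
    using C'(2)[OF u[of "\<sigma> n"]] by (simp add: modular_L_def)
  have AE': "AE x in lebesgue_on \<Omega>. (\<lambda>n. u (\<sigma> n) x) \<longlonglongrightarrow> v x"
    using AE by (simp add: \<sigma>_def)
  have sp: "x \<in> \<Omega>" if "x \<in> space (lebesgue_on \<Omega>)" for x using that by simp
  note conv = modular_tendsto_0_of_AE[of "\<lambda>n. u (\<sigma> n)", OF um v rm' fin' r(1,2)[OF sp] _ bound _ AE']
  have vL: "modular_L \<Omega> r v < \<infinity>" using conv(1) g C'(1) by (simp add: modular_L_def)
  have to0: "\<forall>\<^sub>F n in sequentially. modular_L \<Omega> r (\<lambda>x. u (\<sigma> n) x - v x) \<le> ennreal e" if "0 < e" for e
    using conv(2) g C'(1) that by (simp add: modular_L_def)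
  show "\<exists>v\<in>var_Lebesgue \<Omega> r. \<exists>\<sigma> :: nat \<Rightarrow> nat. strict_mono \<sigma> \<and>
      (\<lambda>n. norm_L \<Omega> r (\<lambda>x. U (\<sigma> n) x - v x)) \<longlonglongrightarrow> 0"
  proof (intro bexI[of _ "\<lambda>x. l * v x"] exI[of _ \<sigma>] conjI \<sigma> norm_L_tendsto_0)
    have "modular_L \<Omega> r (\<lambda>x. l * v x) \<le> ennreal (l powr R) * modular_L \<Omega> r v"
      using r l by (intro modular_L_scale_up v rm') auto
    also have "\<dots> < \<infinity>" using vL by (simp add: ennreal_mult_less_top)
    finally show "(\<lambda>x. l * v x) \<in> var_Lebesgue \<Omega> r" by (simp add: var_Lebesgue_def)
    fix e :: real assume e: "0 < e"
    define k where "k = max 1 (l / e)"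
    have k: "1 \<le> k" "l / e \<le> k" by (auto simp: k_def)
    \<comment> \<open>Scaling by \<open>k \<ge> 1\<close> multiplies the modular by at most \<open>k^R\<close>.\<close>
    have "\<forall>\<^sub>F n in sequentially. modular_L \<Omega> r (\<lambda>x. u (\<sigma> n) x - v x) \<le> ennreal (k powr - R)"
      using k by (intro to0) simp
    then show "\<forall>\<^sub>F n in sequentially. modular_L \<Omega> r (\<lambda>x. (U (\<sigma> n) x - l * v x) / e) \<le> 1"
    proof eventually_elim
      case (elim n)
      have "modular_L \<Omega> r (\<lambda>x. (U (\<sigma> n) x - l * v x) / e) \<le> modular_L \<Omega> r (\<lambda>x. k * (u (\<sigma> n) x - v x))"
      proof (intro modular_L_mono r0)
        fix x
        have "(U (\<sigma> n) x - l * v x) / e = l / e * (u (\<sigma> n) x - v x)"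
          using l by (simp add: u_def right_diff_distrib diff_divide_distrib)
        then have "\<bar>(U (\<sigma> n) x - l * v x) / e\<bar> = l / e * \<bar>u (\<sigma> n) x - v x\<bar>"
          using l e by (simp only: abs_mult) simp
        also have "\<dots> \<le> k * \<bar>u (\<sigma> n) x - v x\<bar>" using k by (intro mult_right_mono) auto
        also have "\<dots> = \<bar>k * (u (\<sigma> n) x - v x)\<bar>" using k by (simp add: abs_mult)
        finally show "\<bar>(U (\<sigma> n) x - l * v x) / e\<bar> \<le> \<bar>k * (u (\<sigma> n) x - v x)\<bar>" .
      qed
      also have "\<dots> \<le> ennreal (k powr R) * modular_L \<Omega> r (\<lambda>x. u (\<sigma> n) x - v x)"
        using r k by (intro modular_L_scale_up rm') auto
      also have "\<dots> \<le> ennreal (k powr R) * ennreal (k powr - R)" using elim by (intro mult_left_mono) auto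
      also have "\<dots> = 1" using k by (simp add: ennreal_mult[symmetric] powr_add[symmetric])
      finally show ?case .
    qed
  qed
qed

lemma crit_exp_continuous: "continuous_on A (crit_exp s p)"
proof -
  have "interp_exp 0 = crit_exp s p" by (simp add: interp_exp_def[abs_def])
  then have "continuous_on UNIV (crit_exp s p)"
    using uniformly_continuous_imp_continuous[OF interp_exp_ucont[of 0]] by simp
  then show ?thesis by (rule continuous_on_subset) simp
qed

end

section \<open>The imbedding theorem\<close>

lemma C_plus_bounds:
  assumes "h \<in> C_plus S"
  shows "x \<in> S \<Longrightarrow> 1 < h x" "x \<in> S \<Longrightarrow> h x \<le> (SUP x\<in>S. h x)" "continuous_on S h"
  using assms unfolding C_plus_def by (auto intro: less_le_trans[OF _ cINF_lower] cSUP_upper)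

theorem theorem3p5:
  fixes s :: real and p :: "(real^'n) \<times> (real^'n) \<Rightarrow> real"
  assumes "0 < s" and "s < 1"
    and "p \<in> C_plus UNIV"
    and "uniformly_continuous_on UNIV p"
    and "\<And>x y. p (x, y) = p (y, x)"
    and "s * (SUP z. p z) < real CARD('n)"
  shows "(\<forall>r \<in> C_plus (UNIV :: (real^'n) set).
            uniformly_continuous_on UNIV r \<longrightarrow>
            (\<forall>x. p (x, x) \<le> r x) \<longrightarrow>
            (INF x. crit_exp s p x - r x) > 0 \<longrightarrow>
            continuously_imbedded (frac_Sobolev s p) (norm_W s p)
              (var_Lebesgue UNIV r) (norm_L UNIV r))
       \<and> (\<forall>r \<in> C_plus (UNIV :: (real^'n) set).
            (\<forall>x. r x < crit_exp s p x) \<longrightarrow>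
            (\<forall>c \<rho>. 0 < \<rho> \<longrightarrow>
              compactly_imbedded (frac_Sobolev s p) (norm_W s p)
                (var_Lebesgue (ball c \<rho>) r) (norm_L (ball c \<rho>) r)))"
proof -
  interpret subcritical_exponent s p "SUP z. p z"
    using assms C_plus_bounds[OF assms(3)] by unfold_locales auto
  show ?thesis
  proof (intro conjI ballI allI impI)
    fix r :: "real^'n \<Rightarrow> real"
    assume r: "r \<in> C_plus UNIV" and pr: "\<forall>x. p (x, x) \<le> r x" and gap: "(INF x. crit_exp s p x - r x) > 0"
    note rb = C_plus_bounds(1,2)[OF r UNIV_I] C_plus_bounds(3)[OF r]
    have "bdd_below (range (\<lambda>x. crit_exp s p x - r x))"
    proof (rule bdd_belowI2)
      fix x show "1 - (SUP x. r x) \<le> crit_exp s p x - r x"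
        using gap_pos[of x] p_gt_1[of "(x, x)"] rb(2)[of x] by linarith
    qed
    then have g: "(INF x. crit_exp s p x - r x) \<le> crit_exp s p x - r x" for x
      by (rule cINF_lower) simp
    have "r x + (INF x. crit_exp s p x - r x) \<le> crit_exp s p x" for x using g[of x] by linarith
    then obtain C where C: "1 \<le> C" "\<And>u. u \<in> modular_ball \<Longrightarrow> modular_L UNIV r u \<le> ennreal C"
      using modular_bounded_global[of r, OF _ rb(2) _ gap] pr by blast
    show "continuously_imbedded (frac_Sobolev s p) (norm_W s p) (var_Lebesgue UNIV r) (norm_L UNIV r)"
      using rb(1) by (intro continuously_imbedded_if_modular_bounded[OF _ _ _ rb(2) C])
        (auto intro!: borel_imp_lebesgue borel_measurable_continuous_onI rb(3) less_imp_le)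
  next
    fix r :: "real^'n \<Rightarrow> real" and c :: "real^'n" and \<rho> :: real
    assume r: "r \<in> C_plus UNIV" and sub: "\<forall>x. r x < crit_exp s p x" and \<rho>: "0 < \<rho>"
    note rb = C_plus_bounds(1,2)[OF r UNIV_I] C_plus_bounds(3)[OF r]
    have "continuous_on (cball c \<rho>) (\<lambda>x. crit_exp s p x - r x)"
      by (intro continuous_on_diff crit_exp_continuous continuous_on_subset[OF rb(3)]) simp
    moreover have "cball c \<rho> \<noteq> {}" using \<rho> by simp
    ultimately obtain x0 where x0: "\<forall>x\<in>cball c \<rho>. crit_exp s p x0 - r x0 \<le> crit_exp s p x - r x"
      using continuous_attains_inf[OF compact_cball] by blast
    show "compactly_imbedded (frac_Sobolev s p) (norm_W s p) (var_Lebesgue (ball c \<rho>) r) (norm_L (ball c \<rho>) r)"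
    proof (rule compactly_imbedded_bounded[where g = "crit_exp s p x0 - r x0"])
      show "r \<in> borel_measurable lebesgue"
        by (intro borel_imp_lebesgue borel_measurable_continuous_onI rb(3))
      show "0 < crit_exp s p x0 - r x0" using sub by simp
      show "r x + (crit_exp s p x0 - r x0) \<le> crit_exp s p x" if "x \<in> ball c \<rho>" for x
        using bspec[OF x0, of x] that by simp
    qed (use rb(1,2) in \<open>auto intro: less_imp_le fmeasurableD[OF lmeasurable_ball]\<close>)
  qed
qed

end
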